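(* Let $B=M/K$ be a connected naturally reductive homogeneous space with $\mathfrak{m}=\mathfrak{k}\oplus\mathfrak{b}$. 1) Let $A,C,E\in\mathfrak{b}$ and $U\in M$. The Jacobi field $\mathfrak{J}^{\mathcal{H}}_{U,C,A,E}$ along the geodesic $\gamma(t)=\mathrm{Exp}_U(d\mathcal{L}_UtA)=U\exp(tA)$ is isotropic if and only if there is $X=X_{\mathfrak{b}}+X_{\mathfrak{k}}\in\mathfrak{m}$ such that $C=X_{\mathfrak{b}}$ and $E=-\frac12[A,C]_{\mathfrak{b}}-[A,X_{\mathfrak{k}}]$. In particular, $\mathfrak{J}^{\mathcal{H}}_{U,0,A,E}$ for $E\in\mathfrak{b}$ is isotropic if and only if $E=-[A,D]$ for some $D\in\mathfrak{k}$. Also, $\mathfrak{J}^{\mathcal{H}}_{U,C,A,-\frac12[A,C]_{\mathfrak{b}}}$ is isotropic. 2) For all $A\in\mathfrak{b}$, the map $\mathrm{ad}^{\mathfrak{b}}_A:X\mapsto[A,X]_{\mathfrak{b}}$ from $\mathfrak{b}$ to itself is anti-self-adjoint under $\langle\cdot,\cdot\rangle_{\mathfrak{b}}$, thus its eigenvalues are either zero or purely imaginary. If $\lambda\sqrt{-1}$ ($\lambda\in\mathbb{R}$, $\lambda\neq0$) is a purely imaginary eigenvalue of $\mathrm{ad}^{\mathfrak{b}}_A$ with eigenvector $V+\sqrt{-1}V_*$, $V,V_*\in\mathfrak{b}$, then $[A,V]=-\lambda V_*+D_*$ and $[A,V_*]=\lambda V+D$ for some $D,D_*\in\mathfrak{k}$.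 If $[A,D_*]=[A,D]=0$ then $$(\mathcal{Z}(t\,\mathrm{ad}_A)V)_{\mathfrak{b}}=\frac{\sin t\lambda}{t\lambda}V-t\,\frac{1-\cos t\lambda}{(t\lambda)^2}[A,V]_{\mathfrak{b}}.$$ Thus $t(\mathcal{Z}(t\,\mathrm{ad}_A)V)_{\mathfrak{b}}=0$ for $t=\frac{2k\pi}{\lambda}$, $k\in\mathbb{Z}$, and the Jacobi field $\mathfrak{J}^{\mathcal{H}}_{U,0,A,V}$ vanishes at those points. In particular, if $[A,\mathfrak{k}]=0$, this formula holds.
   Context: A homogeneous space $B=M/K$ ($M$ a Lie group, $K$ a closed subgroup, Lie algebras $\mathfrak{m},\mathfrak{k}$) is naturally reductive if $\mathfrak{m}=\mathfrak{k}\oplus\mathfrak{b}$ with $[\mathfrak{k},\mathfrak{b}]\subset\mathfrak{b}$ and $\mathfrak{b}$ carries an $\mathrm{Ad}(K)$-invariant positive-definite symmetric bilinear form $\langle\cdot,\cdot\rangle_{\mathfrak{b}}$ with $\langle X,[Z,Y]_{\mathfrak{b}}\rangle_{\mathfrak{b}}+\langle[Z,X]_{\mathfrak{b}},Y\rangle_{\mathfrak{b}}=0$ for $X,Y,Z\in\mathfrak{b}$; it induces the invariant Riemannian metric on $B$. For $S\in\mathfrak{m}$, $S=S_{\mathfrak{b}}+S_{\mathfrak{k}}$ is its decomposition. $\mathcal{L}_U$ is left multiplication by $U\in M$. The horizontal space at $U\in M$ is $d\mathcal{L}_U\mathfrak{b}$, mapped isomorphically to the tangent space of $B$ by the projection $M\to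 B$; this defines horizontal lifts. Geodesics of $B$ lift to the horizontal curves $\gamma(t)=U\exp(tA)$, $A\in\mathfrak{b}$. $\nabla^{\mathcal{H}}$ is the horizontal lift of the Levi-Civita connection of $B$. $\mathfrak{J}^{\mathcal{H}}_{U,C,A,E}$ denotes the horizontal lift along $\gamma(t)=U\exp(tA)$ of the Jacobi field on $B$ determined by $\mathfrak{J}^{\mathcal{H}}(0)=d\mathcal{L}_UC$, $\nabla^{\mathcal{H}}_{d/dt}\mathfrak{J}^{\mathcal{H}}(0)=d\mathcal{L}_UE$; explicitly it equals $d\mathcal{L}_{\gamma(t)}\{C+t\mathcal{Z}(t\,\mathrm{ad}_A)(\frac12[A,C]_{\mathfrak{b}}+E-[A,C])\}_{\mathfrak{b}}$, where $\mathcal{Z}(x)=\frac{1-\exp(-x)}{x}=\sum_{n\ge0}\frac{(-1)^n}{(n+1)!}x^n$. It is called isotropic if there is $X\in\mathfrak{m}$ with $\mathfrak{J}^{\mathcal{H}}(t)=d\mathcal{L}_{\gamma(t)}(\exp(-t\,\mathrm{ad}_A)X)_{\mathfrak{b}}$ for all $t$. Expressions such as $\frac{\sin t\lambda}{t\lambda}$ are interpreted at $t=0$ by continuity. *)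

theory Defs
  imports "HOL-Analysis.Analysis" "HOL-Algebra.Coset"
begin

text \<open>
  The underlying set of the Lie group is a whole type \<open>'g\<close>, whose topology is given by
  the type class. Charts take values in a finite-dimensional normed space \<open>'a\<close>, and the same
  space carries the Lie algebra (it has the right dimension). The norm on \<open>'a\<close> only serves to
  express limits; it is unrelated to the invariant metric. The class \<open>real_normed_vector\<close>
  together with a finite spanning set is used instead of \<open>euclidean_space\<close> because the latter
  excludes dimension zero.
\<close>

section \<open>Lie groups\<close>

text \<open>For open \<open>S\<close> in a finite-dimensional space this is the class of k times
  continuously differentiable maps.\<close>

primrec Ck_on :: "nat \<Rightarrow> 'a::real_normed_vector set \<Rightarrow> ('a \<Rightarrow> 'b::real_normed_vector) \<Rightarrow> bool" where
  "Ck_on 0 S f \<longleftrightarrow> continuous_on S f"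
| "Ck_on (Suc k) S f \<longleftrightarrow> (\<forall>x\<in>S. f differentiable (at x)) \<and>
     (\<forall>v. Ck_on k S (\<lambda>x. frechet_derivative f (at x) v))"

definition smooth_on :: "'a::real_normed_vector set \<Rightarrow> ('a \<Rightarrow> 'b::real_normed_vector) \<Rightarrow> bool" where
  "smooth_on S f \<longleftrightarrow> (\<forall>k. Ck_on k S f)"

text \<open>The field \<open>livf\<close> identifies \<open>'a\<close> with the Lie algebra of left-invariant vector fields,
  viewed as derivations of the algebra of smooth functions: \<open>livf M A f g\<close> is the derivative of
  \<open>f\<close> at \<open>g\<close> in the direction of the left-invariant field generated by \<open>A\<close>.\<close>

record ('g, 'a) lie_data = "'g monoid" +
  atlas :: "('g set \<times> ('g \<Rightarrow> 'a)) set"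
  livf :: "'a \<Rightarrow> ('g \<Rightarrow> real) \<Rightarrow> ('g \<Rightarrow> real)"

type_synonym 'g tangent = "('g \<Rightarrow> real) \<Rightarrow> real"

definition smooth_atlas ::
  "('g::topological_space set \<times> ('g \<Rightarrow> 'a::real_normed_vector)) set \<Rightarrow> bool" where
  "smooth_atlas \<A> \<longleftrightarrow>
     (\<Union>(W, \<phi>)\<in>\<A>. W) = UNIV \<and>
     (\<forall>(W, \<phi>)\<in>\<A>. open W \<and> open (\<phi> ` W) \<and> inj_on \<phi> W \<and>
        homeomorphism W (\<phi> ` W) \<phi> (inv_into W \<phi>)) \<and>
     (\<forall>(W, \<phi>)\<in>\<A>. \<forall>(W', \<psi>)\<in>\<A>. smooth_on (\<phi> ` (W \<inter> W')) (\<psi> \<circ> inv_into W \<phi>))"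

definition smooth_map ::
  "('g::topological_space, 'a::real_normed_vector, 'z) lie_data_scheme \<Rightarrow>
   ('g \<Rightarrow> 'b::real_normed_vector) \<Rightarrow> bool" where
  "smooth_map M f \<longleftrightarrow> (\<forall>(W, \<phi>)\<in>atlas M. smooth_on (\<phi> ` W) (f \<circ> inv_into W \<phi>))"

text \<open>Derivations are only meaningful on smooth functions; the value zero elsewhere makes the
  operator determined by the vector field.\<close>

definition left_invariant_fields ::
  "('g::topological_space, 'a::real_normed_vector, 'z) lie_data_scheme \<Rightarrow>
   (('g \<Rightarrow> real) \<Rightarrow> ('g \<Rightarrow> real)) set" where
  "left_invariant_fields M = {D.
     (\<forall>f. smooth_map M f \<longrightarrow> smooth_map M (D f)) \<and>
     (\<forall>f. \<not> smooth_map M f \<longrightarrow> D f = (\<lambda>_. 0)) \<and>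
     (\<forall>f h. smooth_map M f \<longrightarrow> smooth_map M h \<longrightarrow> D (\<lambda>x. f x + h x) = (\<lambda>x. D f x + D h x)) \<and>
     (\<forall>f c. smooth_map M f \<longrightarrow> D (\<lambda>x. c * f x) = (\<lambda>x. c * D f x)) \<and>
     (\<forall>f h. smooth_map M f \<longrightarrow> smooth_map M h \<longrightarrow>
        D (\<lambda>x. f x * h x) = (\<lambda>x. D f x * h x + f x * D h x)) \<and>
     (\<forall>f g. smooth_map M f \<longrightarrow> D (\<lambda>x. f (g \<otimes>\<^bsub>M\<^esub> x)) = (\<lambda>x. D f (g \<otimes>\<^bsub>M\<^esub> x)))}"

definition lie_group ::
  "('g::{t2_space, second_countable_topology}, 'a::real_normed_vector, 'z) lie_data_scheme \<Rightarrow> bool"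
  where
  "lie_group M \<longleftrightarrow>
     group M \<and> carrier M = UNIV \<and>
     (\<exists>S::'a set. finite S \<and> span S = UNIV) \<and>
     smooth_atlas (atlas M) \<and>
     continuous_on UNIV (\<lambda>(g, h). g \<otimes>\<^bsub>M\<^esub> h) \<and>
     (\<forall>(W1, \<phi>1)\<in>atlas M. \<forall>(W2, \<phi>2)\<in>atlas M. \<forall>(W3, \<phi>3)\<in>atlas M.
        smooth_on {(x, y). x \<in> \<phi>1 ` W1 \<and> y \<in> \<phi>2 ` W2 \<and>
                     inv_into W1 \<phi>1 x \<otimes>\<^bsub>M\<^esub> inv_into W2 \<phi>2 y \<in> W3}
          (\<lambda>(x, y). \<phi>3 (inv_into W1 \<phi>1 x \<otimes>\<^bsub>M\<^esub> inv_into W2 \<phi>2 y))) \<and>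
     continuous_on UNIV (\<lambda>g. inv\<^bsub>M\<^esub> g) \<and>
     (\<forall>(W1, \<phi>1)\<in>atlas M. \<forall>(W2, \<phi>2)\<in>atlas M.
        smooth_on {x. x \<in> \<phi>1 ` W1 \<and> inv\<^bsub>M\<^esub> (inv_into W1 \<phi>1 x) \<in> W2}
          (\<lambda>x. \<phi>2 (inv\<^bsub>M\<^esub> (inv_into W1 \<phi>1 x)))) \<and>
     (\<forall>A B f g. livf M (A + B) f g = livf M A f g + livf M B f g) \<and>
     (\<forall>c A f g. livf M (c *\<^sub>R A) f g = c * livf M A f g) \<and>
     bij_betw (livf M) UNIV (left_invariant_fields M)"

definition lie_bracket :: "('g, 'a, 'z) lie_data_scheme \<Rightarrow> 'a \<Rightarrow> 'a \<Rightarrow> 'a" where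
  "lie_bracket M A B =
     (THE C. \<forall>f. livf M C f = (\<lambda>g. livf M A (livf M B f) g - livf M B (livf M A f) g))"

definition tangent_at_one :: "('g, 'a, 'z) lie_data_scheme \<Rightarrow> 'a \<Rightarrow> 'g tangent" where
  "tangent_at_one M A = (\<lambda>f. livf M A f \<one>\<^bsub>M\<^esub>)"

text \<open>Differential of the left multiplication by \<open>g\<close>, at the identity.\<close>

definition dL :: "('g, 'a, 'z) lie_data_scheme \<Rightarrow> 'g \<Rightarrow> 'a \<Rightarrow> 'g tangent" where
  "dL M g A = (\<lambda>f. tangent_at_one M A (\<lambda>x. f (g \<otimes>\<^bsub>M\<^esub> x)))"

definition one_parameter_subgroup ::
  "('g::topological_space, 'a::real_normed_vector, 'z) lie_data_scheme \<Rightarrow> 'a \<Rightarrow> (real \<Rightarrow> 'g) \<Rightarrow> bool"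
  where
  "one_parameter_subgroup M A c \<longleftrightarrow>
     (\<forall>s t. c (s + t) = c s \<otimes>\<^bsub>M\<^esub> c t) \<and>
     (\<forall>f t. smooth_map M f \<longrightarrow> ((\<lambda>s. f (c s)) has_real_derivative livf M A f (c t)) (at t))"

definition lie_exp ::
  "('g::topological_space, 'a::real_normed_vector, 'z) lie_data_scheme \<Rightarrow> 'a \<Rightarrow> 'g" where
  "lie_exp M A = (THE c. one_parameter_subgroup M A c) 1"

text \<open>\<open>Ad g\<close> is the differential at the identity of the conjugation by \<open>g\<close>.\<close>

definition Ad ::
  "('g::topological_space, 'a::real_normed_vector, 'z) lie_data_scheme \<Rightarrow> 'g \<Rightarrow> 'a \<Rightarrow> 'a" where
  "Ad M g A = (THE B. \<forall>f. smooth_map M f \<longrightarrow>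
     tangent_at_one M B f = tangent_at_one M A (\<lambda>x. f (g \<otimes>\<^bsub>M\<^esub> x \<otimes>\<^bsub>M\<^esub> inv\<^bsub>M\<^esub> g)))"

definition exp_ad ::
  "('g, 'a::real_normed_vector, 'z) lie_data_scheme \<Rightarrow> real \<Rightarrow> 'a \<Rightarrow> 'a \<Rightarrow> 'a" where
  "exp_ad M s A X = (\<Sum>n. (s ^ n / fact n) *\<^sub>R (lie_bracket M A ^^ n) X)"

text \<open>\<open>\<Z>(s ad\<^sub>A)\<close> for \<open>\<Z>(x) = (1 - exp (-x)) / x\<close>.\<close>

definition Z_ad ::
  "('g, 'a::real_normed_vector, 'z) lie_data_scheme \<Rightarrow> real \<Rightarrow> 'a \<Rightarrow> 'a \<Rightarrow> 'a" where
  "Z_ad M s A X = (\<Sum>n. ((-1) ^ n / fact (n + 1) * s ^ n) *\<^sub>R (lie_bracket M A ^^ n) X)"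

section \<open>Naturally reductive homogeneous spaces\<close>

record ('g, 'a) homogeneous_data = "('g, 'a) lie_data" +
  isotropy :: "'g set"
  hor :: "'a set"
  form :: "'a \<Rightarrow> 'a \<Rightarrow> real"

text \<open>The Lie algebra of the closed subgroup \<open>K\<close>.\<close>

definition isotropy_algebra ::
  "('g::topological_space, 'a::real_normed_vector, 'z) homogeneous_data_scheme \<Rightarrow> 'a set" where
  "isotropy_algebra M = {A. \<forall>t::real. lie_exp M (t *\<^sub>R A) \<in> isotropy M}"

definition hor_part ::
  "('g::topological_space, 'a::real_normed_vector, 'z) homogeneous_data_scheme \<Rightarrow> 'a \<Rightarrow> 'a" where
  "hor_part M X = (THE Y. Y \<in> hor M \<and> X - Y \<in> isotropy_algebra M)"

definition iso_part ::
  "('g::topological_space, 'a::real_normed_vector, 'z) homogeneous_data_scheme \<Rightarrow> 'a \<Rightarrow> 'a" where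
  "iso_part M X = (THE Y. Y \<in> isotropy_algebra M \<and> X - Y \<in> hor M)"

definition hor_bracket ::
  "('g::topological_space, 'a::real_normed_vector, 'z) homogeneous_data_scheme \<Rightarrow> 'a \<Rightarrow> 'a \<Rightarrow> 'a"
  where
  "hor_bracket M A X = hor_part M (lie_bracket M A X)"

text \<open>The set of cosets \<open>gK\<close> with the quotient topology.\<close>

definition coset_topology ::
  "('g::topological_space, 'a, 'z) homogeneous_data_scheme \<Rightarrow> 'g set topology" where
  "coset_topology M = topology (\<lambda>\<W>. \<W> \<subseteq> range (\<lambda>g. g <#\<^bsub>M\<^esub> isotropy M) \<and>
     open {g. g <#\<^bsub>M\<^esub> isotropy M \<in> \<W>})"

lemma openin_coset_topology:
  "openin (coset_topology M) \<W> \<longleftrightarrow> \<W> \<subseteq> range (\<lambda>g. g <#\<^bsub>M\<^esub> isotropy M) \<and>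
     open {g. g <#\<^bsub>M\<^esub> isotropy M \<in> \<W>}"
proof -
  have "istopology (\<lambda>\<W>. \<W> \<subseteq> range (\<lambda>g. g <#\<^bsub>M\<^esub> isotropy M) \<and>
     open {g. g <#\<^bsub>M\<^esub> isotropy M \<in> \<W>})"
    unfolding istopology_def
  proof (intro conjI allI impI)
    fix S T :: "'a set set"
    assume "S \<subseteq> range (\<lambda>g. g <#\<^bsub>M\<^esub> isotropy M) \<and> open {g. g <#\<^bsub>M\<^esub> isotropy M \<in> S}"
      and "T \<subseteq> range (\<lambda>g. g <#\<^bsub>M\<^esub> isotropy M) \<and> open {g. g <#\<^bsub>M\<^esub> isotropy M \<in> T}"
    then show "S \<inter> T \<subseteq> range (\<lambda>g. g <#\<^bsub>M\<^esub> isotropy M)"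
      and "open {g. g <#\<^bsub>M\<^esub> isotropy M \<in> S \<inter> T}"
      by (auto intro: open_Collect_conj)
  next
    fix F :: "'a set set set"
    assume F: "\<forall>S\<in>F. S \<subseteq> range (\<lambda>g. g <#\<^bsub>M\<^esub> isotropy M) \<and>
      open {g. g <#\<^bsub>M\<^esub> isotropy M \<in> S}"
    then show "\<Union>F \<subseteq> range (\<lambda>g. g <#\<^bsub>M\<^esub> isotropy M)" by blast
    have "{g. g <#\<^bsub>M\<^esub> isotropy M \<in> \<Union>F} = (\<Union>S\<in>F. {g. g <#\<^bsub>M\<^esub> isotropy M \<in> S})" by auto
    then show "open {g. g <#\<^bsub>M\<^esub> isotropy M \<in> \<Union>F}" using F by auto
  qed
  then show ?thesis unfolding coset_topology_def by (simp add: topology_inverse')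
qed

definition naturally_reductive ::
  "('g::{t2_space, second_countable_topology}, 'a::real_normed_vector, 'z) homogeneous_data_scheme
   \<Rightarrow> bool" where
  "naturally_reductive M \<longleftrightarrow>
     lie_group M \<and> subgroup (isotropy M) M \<and> closed (isotropy M) \<and>
     subspace (isotropy_algebra M) \<and> subspace (hor M) \<and>
     isotropy_algebra M \<inter> hor M = {0} \<and>
     (\<forall>X. \<exists>Y\<in>isotropy_algebra M. \<exists>Z\<in>hor M. X = Y + Z) \<and>
     (\<forall>D\<in>isotropy_algebra M. \<forall>X\<in>hor M. lie_bracket M D X \<in> hor M) \<and>
     (\<forall>X\<in>hor M. \<forall>Y\<in>hor M. \<forall>Z\<in>hor M. form M (X + Y) Z = form M X Z + form M Y Z) \<and>
     (\<forall>X\<in>hor M. \<forall>Y\<in>hor M. \<forall>c. form M (c *\<^sub>R X) Y = c * form M X Y) \<and>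
     (\<forall>X\<in>hor M. \<forall>Y\<in>hor M. form M X Y = form M Y X) \<and>
     (\<forall>X\<in>hor M. X \<noteq> 0 \<longrightarrow> form M X X > 0) \<and>
     (\<forall>k\<in>isotropy M. \<forall>X\<in>hor M. Ad M k X \<in> hor M) \<and>
     (\<forall>k\<in>isotropy M. \<forall>X\<in>hor M. \<forall>Y\<in>hor M. form M (Ad M k X) (Ad M k Y) = form M X Y) \<and>
     (\<forall>X\<in>hor M. \<forall>Y\<in>hor M. \<forall>Z\<in>hor M.
        form M X (hor_bracket M Z Y) + form M (hor_bracket M Z X) Y = 0)"

section \<open>The lifted Levi-Civita connection and Jacobi fields\<close>

text \<open>
  A smooth vector field on the group is written as a smooth map \<open>S\<close> into the Lie algebra, with
  value \<open>dL M g (S g)\<close> at \<open>g\<close>; it is horizontal iff \<open>S\<close> takes values in \<open>hor M\<close>. A horizontal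
  field \<open>Y\<close> is the horizontal lift of a vector field on the quotient iff all vectors along a
  fibre project to the same vector, i.e. \<open>Y (g k) = Ad (k\<^sup>-\<^sup>1) (Y g)\<close> for \<open>k\<close> in the isotropy
  group.
\<close>

definition field_deriv ::
  "('g, 'a, 'z) lie_data_scheme \<Rightarrow> ('g \<Rightarrow> 'a) \<Rightarrow> ('g \<Rightarrow> real) \<Rightarrow> 'g \<Rightarrow> real" where
  "field_deriv M S f = (\<lambda>g. livf M (S g) f g)"

definition horizontal_field ::
  "('g::topological_space, 'a::real_normed_vector, 'z) homogeneous_data_scheme \<Rightarrow> ('g \<Rightarrow> 'a) \<Rightarrow> bool"
  where
  "horizontal_field M Y \<longleftrightarrow> smooth_map M Y \<and> (\<forall>g. Y g \<in> hor M)"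

definition lifted_field ::
  "('g::topological_space, 'a::real_normed_vector, 'z) homogeneous_data_scheme \<Rightarrow> ('g \<Rightarrow> 'a) \<Rightarrow> bool"
  where
  "lifted_field M Y \<longleftrightarrow> horizontal_field M Y \<and>
     (\<forall>g. \<forall>k\<in>isotropy M. Y (g \<otimes>\<^bsub>M\<^esub> k) = Ad M (inv\<^bsub>M\<^esub> k) (Y g))"

text \<open>
  Under the projection \<open>\<pi>\<close> of the group onto the quotient, the horizontal bundle is the pullback
  of the tangent bundle of the quotient, and \<open>nabla\<close> below is the pullback of the Levi-Civita
  connection, written in left trivialisation. The axioms say, in this order: \<open>nabla\<close> is a connection
  on the horizontal bundle; it is the pullback of a connection on the quotient (horizontal lifts
  are mapped to horizontal lifts, and are parallel in vertical directions); it is metric; it is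
  torsion free, \<open>nabla S (d\<pi> T) - nabla T (d\<pi> S) = d\<pi> [S, T]\<close>, where \<open>R\<close> is the commutator of the
  vector fields \<open>S\<close> and \<open>T\<close>. Restricted to horizontal lifts these are the axioms of the
  Levi-Civita connection of the quotient, so \<open>nabla\<close> is uniquely determined on smooth fields.
\<close>

definition lifted_levi_civita ::
  "('g::topological_space, 'a::real_normed_vector, 'z) homogeneous_data_scheme \<Rightarrow>
   (('g \<Rightarrow> 'a) \<Rightarrow> ('g \<Rightarrow> 'a) \<Rightarrow> ('g \<Rightarrow> 'a)) \<Rightarrow> bool" where
  "lifted_levi_civita M nabla \<longleftrightarrow>
     (\<forall>S Y. smooth_map M S \<longrightarrow> horizontal_field M Y \<longrightarrow> horizontal_field M (nabla S Y)) \<and>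
     (\<forall>S T Y. smooth_map M S \<longrightarrow> smooth_map M T \<longrightarrow> horizontal_field M Y \<longrightarrow>
        nabla (\<lambda>g. S g + T g) Y = (\<lambda>g. nabla S Y g + nabla T Y g)) \<and>
     (\<forall>f S Y. smooth_map M f \<longrightarrow> smooth_map M S \<longrightarrow> horizontal_field M Y \<longrightarrow>
        nabla (\<lambda>g. f g *\<^sub>R S g) Y = (\<lambda>g. f g *\<^sub>R nabla S Y g)) \<and>
     (\<forall>S Y Z. smooth_map M S \<longrightarrow> horizontal_field M Y \<longrightarrow> horizontal_field M Z \<longrightarrow>
        nabla S (\<lambda>g. Y g + Z g) = (\<lambda>g. nabla S Y g + nabla S Z g)) \<and>
     (\<forall>f S Y. smooth_map M f \<longrightarrow> smooth_map M S \<longrightarrow> horizontal_field M Y \<longrightarrow>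
        nabla S (\<lambda>g. f g *\<^sub>R Y g) = (\<lambda>g. field_deriv M S f g *\<^sub>R Y g + f g *\<^sub>R nabla S Y g)) \<and>
     (\<forall>X Y. lifted_field M X \<longrightarrow> lifted_field M Y \<longrightarrow> lifted_field M (nabla X Y)) \<and>
     (\<forall>V Y. smooth_map M V \<longrightarrow> (\<forall>g. V g \<in> isotropy_algebra M) \<longrightarrow> lifted_field M Y \<longrightarrow>
        nabla V Y = (\<lambda>_. 0)) \<and>
     (\<forall>S Y Z. smooth_map M S \<longrightarrow> horizontal_field M Y \<longrightarrow> horizontal_field M Z \<longrightarrow>
        field_deriv M S (\<lambda>g. form M (Y g) (Z g)) =
        (\<lambda>g. form M (nabla S Y g) (Z g) + form M (Y g) (nabla S Z g))) \<and>
     (\<forall>S T R. smooth_map M S \<longrightarrow> smooth_map M T \<longrightarrow> smooth_map M R \<longrightarrow>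
        (\<forall>f::'g \<Rightarrow> real. smooth_map M f \<longrightarrow> field_deriv M R f =
           (\<lambda>g. field_deriv M S (field_deriv M T f) g - field_deriv M T (field_deriv M S f) g)) \<longrightarrow>
        (\<forall>g. nabla S (\<lambda>x. hor_part M (T x)) g - nabla T (\<lambda>x. hor_part M (S x)) g = hor_part M (R g)))"

text \<open>The horizontal lift \<open>R(X, Y) Z = \<nabla>\<^sub>X \<nabla>\<^sub>Y Z - \<nabla>\<^sub>Y \<nabla>\<^sub>X Z - \<nabla>\<^bsub>[X,Y]\<^esub> Z\<close> of the curvature
  tensor at \<open>g\<close>. It is tensorial, so it may be computed by extending its arguments to the
  left-invariant fields they generate, which are the constant maps in left trivialisation.\<close>

definition lifted_curvature ::
  "('g, 'a::real_normed_vector, 'z) lie_data_scheme \<Rightarrow> (('g \<Rightarrow> 'a) \<Rightarrow> ('g \<Rightarrow> 'a) \<Rightarrow> ('g \<Rightarrow> 'a)) \<Rightarrow>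
   'g \<Rightarrow> 'a \<Rightarrow> 'a \<Rightarrow> 'a \<Rightarrow> 'a" where
  "lifted_curvature M nabla g X Y Z =
     nabla (\<lambda>_. X) (nabla (\<lambda>_. Y) (\<lambda>_. Z)) g - nabla (\<lambda>_. Y) (nabla (\<lambda>_. X) (\<lambda>_. Z)) g
     - nabla (\<lambda>_. lie_bracket M X Y) (\<lambda>_. Z) g"

definition geodesic_lift ::
  "('g::topological_space, 'a::real_normed_vector, 'z) lie_data_scheme \<Rightarrow> 'g \<Rightarrow> 'a \<Rightarrow> real \<Rightarrow> 'g" where
  "geodesic_lift M U A t = U \<otimes>\<^bsub>M\<^esub> lie_exp M (t *\<^sub>R A)"

text \<open>Covariant derivative of the horizontal field \<open>dL M (\<gamma> t) (y t)\<close> along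
  \<open>\<gamma> = geodesic_lift M U A\<close>, in left trivialisation. The velocity of \<open>\<gamma>\<close> is \<open>dL M (\<gamma> t) A\<close>, so in
  a frame \<open>e\<^sub>i\<close> of left-invariant horizontal fields, where \<open>y = \<Sum> y\<^sub>i e\<^sub>i\<close>, the usual expression
  \<open>\<Sum> (y\<^sub>i' e\<^sub>i + y\<^sub>i \<nabla>\<^bsub>\<gamma>'\<^esub> e\<^sub>i)\<close> becomes the following.\<close>

definition cov_deriv ::
  "('g::topological_space, 'a::real_normed_vector, 'z) lie_data_scheme \<Rightarrow>
   (('g \<Rightarrow> 'a) \<Rightarrow> ('g \<Rightarrow> 'a) \<Rightarrow> ('g \<Rightarrow> 'a)) \<Rightarrow> 'g \<Rightarrow> 'a \<Rightarrow> (real \<Rightarrow> 'a) \<Rightarrow> real \<Rightarrow> 'a" where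
  "cov_deriv M nabla U A y t =
     vector_derivative y (at t) + nabla (\<lambda>_. A) (\<lambda>_. y t) (geodesic_lift M U A t)"

text \<open>The lifted Jacobi equation \<open>J'' + R(J, \<gamma>') \<gamma>' = 0\<close> with \<open>J(0) = dL M U C\<close> and
  \<open>J'(0) = dL M U E\<close>.\<close>

definition jacobi_solution ::
  "('g::topological_space, 'a::real_normed_vector, 'z) homogeneous_data_scheme \<Rightarrow>
   (('g \<Rightarrow> 'a) \<Rightarrow> ('g \<Rightarrow> 'a) \<Rightarrow> ('g \<Rightarrow> 'a)) \<Rightarrow> 'g \<Rightarrow> 'a \<Rightarrow> 'a \<Rightarrow> 'a \<Rightarrow> (real \<Rightarrow> 'a) \<Rightarrow> bool" where
  "jacobi_solution M nabla U C A E y \<longleftrightarrow>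
     (\<forall>t. y t \<in> hor M) \<and>
     (\<forall>t. y differentiable (at t)) \<and>
     (\<forall>t. cov_deriv M nabla U A y differentiable (at t)) \<and>
     (\<forall>t. cov_deriv M nabla U A (cov_deriv M nabla U A y) t
          + lifted_curvature M nabla (geodesic_lift M U A t) (y t) A A = 0) \<and>
     y 0 = C \<and> cov_deriv M nabla U A y 0 = E"

definition jacobi_lift ::
  "('g::topological_space, 'a::real_normed_vector, 'z) homogeneous_data_scheme \<Rightarrow>
   (('g \<Rightarrow> 'a) \<Rightarrow> ('g \<Rightarrow> 'a) \<Rightarrow> ('g \<Rightarrow> 'a)) \<Rightarrow> 'g \<Rightarrow> 'a \<Rightarrow> 'a \<Rightarrow> 'a \<Rightarrow> real \<Rightarrow> 'g tangent" where
  "jacobi_lift M nabla U C A E t =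
     dL M (geodesic_lift M U A t) ((THE y. jacobi_solution M nabla U C A E y) t)"

definition isotropic ::
  "('g::topological_space, 'a::real_normed_vector, 'z) homogeneous_data_scheme \<Rightarrow>
   'g \<Rightarrow> 'a \<Rightarrow> (real \<Rightarrow> 'g tangent) \<Rightarrow> bool" where
  "isotropic M U A J \<longleftrightarrow>
     (\<exists>X. \<forall>t. J t = dL M (geodesic_lift M U A t) (hor_part M (exp_ad M (- t) A X)))"

section \<open>Eigenvectors of the complexification\<close>

text \<open>\<open>V + i W\<close> is an eigenvector, with eigenvalue \<open>\<mu>\<close>, of the complex-linear extension of \<open>L\<close>;
  the equation \<open>L V + i L W = \<mu> (V + i W)\<close> is split into real and imaginary parts.\<close>

definition complex_eigenvector ::
  "('a::real_vector \<Rightarrow> 'a) \<Rightarrow> complex \<Rightarrow> 'a \<Rightarrow> 'a \<Rightarrow> bool" where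
  "complex_eigenvector L \<mu> V W \<longleftrightarrow> (V, W) \<noteq> (0, 0) \<and>
     L V = Re \<mu> *\<^sub>R V - Im \<mu> *\<^sub>R W \<and> L W = Im \<mu> *\<^sub>R V + Re \<mu> *\<^sub>R W"

text \<open>\<open>sin x / x\<close> and \<open>(1 - cos x) / x\<^sup>2\<close>, extended continuously to \<open>x = 0\<close>.\<close>

definition sin_quot :: "real \<Rightarrow> real" where
  "sin_quot x = (if x = 0 then 1 else sin x / x)"

definition cos_quot :: "real \<Rightarrow> real" where
  "cos_quot x = (if x = 0 then 1 / 2 else (1 - cos x) / x\<^sup>2)"

end

theory Submission
  imports Defs
begin

text \<open>
  In the left trivialisation everything takes place in the Lie algebra. There the theorem is about
  a linear differential equation with constant coefficients. Write \<open>N X\<close> for the horizontal part of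
  \<open>[A, X]\<close> and \<open>P X\<close> for the bracket of \<open>A\<close> with the vertical part of \<open>[A, X]\<close>.

  The connection is determined by its axioms on left-invariant fields. For horizontal \<open>X\<close>, \<open>Y\<close> it
  is half the horizontal bracket (\<open>nabla_hor\<close>): this is the Koszul argument, and natural
  reductivity says that half the bracket is compatible with the metric. For vertical \<open>D\<close> the torsion
  axiom yields \<open>[D, Y]\<close> (\<open>nabla_iso\<close>). Hence the curvature is \<open>R(X, A) A = - N\<^sup>2 X / 4 - P X\<close>
  (\<open>lifted_curvature_eq\<close>). The covariant derivative along the geodesic is \<open>d/dt + N/2\<close>, so the
  Jacobi equation becomes \<open>y'' + N y' - P y = 0\<close>.

  Solutions of this equation come from the curve \<open>x(t) = exp (- t ad\<^sub>A) X\<close>, which solves \<open>x' = - [A, x]\<close>, in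
  two ways. The horizontal part of \<open>x\<close> is a solution (\<open>isotropic_jacobi_solution\<close>); these are the
  isotropic fields. A primitive of the horizontal part of \<open>x\<close> is a solution if the vertical part of
  \<open>X\<close> fits the constant of integration (\<open>explicit_jacobi_field_solution\<close>); this gives solutions
  with arbitrary initial values, in terms of \<open>\<Z>\<close>. Since solutions are determined by their
  initial values (\<open>jacobi_solution_unique\<close>), a Jacobi field is isotropic iff its initial values are
  those of the horizontal part of some \<open>x\<close>, which is the first part of the theorem.

  For the second part, if \<open>[A, D] = [A, D'] = 0\<close> then the cube of \<open>ad\<^sub>A\<close> acts on \<open>V\<close> as \<open>- \<omega>\<^sup>2 ad\<^sub>A\<close>, so
  the horizontal part of the series \<open>\<Z>(t ad\<^sub>A) V\<close> splits into a sine and a cosine series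
  (\<open>scaled_Z_ad_eigenvector\<close>).

  Analysis in the Lie algebra rests on the boundedness of coordinates in a finite-dimensional
  normed space (\<open>independent_coefficients_bounded\<close>). It makes linear maps continuous and the
  exponential series convergent.
\<close>

section \<open>Finite-dimensional normed spaces\<close>

text \<open>
  Induction on the basis. By induction hypothesis the span of the smaller set is complete, hence
  closed, so the new vector \<open>b\<close> has positive distance \<open>\<delta>\<close> from it. This bounds the coefficient of
  \<open>b\<close> by \<open>1 / \<delta>\<close> times the norm, and the remaining vector by the triangle inequality. The
  argument replaces the compactness of the unit sphere, for which one would first have to
  identify the span with some \<open>\<real>\<^sup>n\<close>.
\<close>

lemma independent_coefficients_bounded:
  fixes B :: "'a::real_normed_vector set"
  assumes "finite B" "independent B"
  shows "\<exists>C. \<forall>a. \<forall>b\<in>B. \<bar>a b\<bar> \<le> C * norm (\<Sum>c\<in>B. a c *\<^sub>R c)"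
  using assms
proof (induction B rule: finite_induct)
  case empty
  then show ?case by simp
next
  case (insert b B)
  have ind: "independent B" and b: "b \<notin> span B"
    using insert.prems insert.hyps by (simp_all add: independent_insert)
  obtain C where C: "\<And>a c. c \<in> B \<Longrightarrow> \<bar>a c\<bar> \<le> C * norm (\<Sum>c\<in>B. a c *\<^sub>R c)"
    using insert.IH[OF ind] by blast
  have "\<exists>\<delta>>0. \<forall>a. \<delta> \<le> norm (b - (\<Sum>c\<in>B. a c *\<^sub>R c))"
  proof (rule ccontr)
    assume neg: "\<not> ?thesis"
    have "\<exists>a. norm (b - (\<Sum>c\<in>B. a c *\<^sub>R c)) < inverse (real (Suc n))" for n
    proof -
      have "inverse (real (Suc n)) > 0" by simp
      then have "\<not> (\<forall>a. inverse (real (Suc n)) \<le> norm (b - (\<Sum>c\<in>B. a c *\<^sub>R c)))"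
        using neg by blast
      then show ?thesis by (simp add: not_le)
    qed
    then obtain a where a: "\<And>n. norm (b - (\<Sum>c\<in>B. a n c *\<^sub>R c)) < inverse (real (Suc n))"
      using choice[of "\<lambda>n a. norm (b - (\<Sum>c\<in>B. a c *\<^sub>R c)) < inverse (real (Suc n))"] by blast
    define s where "s n = (\<Sum>c\<in>B. a n c *\<^sub>R c)" for n
    \<comment> \<open>If the distance were zero, the span of \<open>B\<close> would contain a sequence with limit \<open>b\<close>; its coefficients converge.\<close>
    have "(\<lambda>n. s n - b) \<longlonglongrightarrow> 0"
    proof (rule Lim_null_comparison[OF always_eventually LIMSEQ_inverse_real_of_nat], rule allI)
      show "norm (s n - b) \<le> inverse (real (Suc n))" for n
        using a[of n] by (simp add: s_def norm_minus_commute)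
    qed
    then have lim: "s \<longlonglongrightarrow> b" by (rule LIM_zero_cancel)
    then have "Cauchy s" by (rule LIMSEQ_imp_Cauchy)
    have "Cauchy (\<lambda>n. a n c)" if c: "c \<in> B" for c
    proof (rule CauchyI)
      fix e :: real
      assume e: "e > 0"
      have C1: "0 < \<bar>C\<bar> + 1" by simp
      obtain m where m: "\<And>i j. i \<ge> m \<Longrightarrow> j \<ge> m \<Longrightarrow> norm (s i - s j) < e / (\<bar>C\<bar> + 1)"
        using CauchyD[OF \<open>Cauchy s\<close>, of "e / (\<bar>C\<bar> + 1)"] e C1 by auto
      have "norm (a i c - a j c) < e" if "i \<ge> m" "j \<ge> m" for i j
      proof -
        have "\<bar>a i c - a j c\<bar> \<le> C * norm (s i - s j)"
          using C[OF c, of "\<lambda>c. a i c - a j c"] by (simp add: s_def scaleR_diff_left sum_subtractf)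
        also have "\<dots> \<le> (\<bar>C\<bar> + 1) * norm (s i - s j)" by (intro mult_right_mono) auto
        also have "\<dots> < (\<bar>C\<bar> + 1) * (e / (\<bar>C\<bar> + 1))"
          using m[OF that] C1 by (intro mult_strict_left_mono) auto
        also have "\<dots> = e" using C1 by simp
        finally show ?thesis by simp
      qed
      then show "\<exists>M. \<forall>m\<ge>M. \<forall>n\<ge>M. norm (a m c - a n c) < e" by blast
    qed
    then have "\<forall>c\<in>B. \<exists>l. (\<lambda>n. a n c) \<longlonglongrightarrow> l"
      using Cauchy_convergent convergent_def by blast
    from bchoice[OF this] obtain l where l: "\<And>c. c \<in> B \<Longrightarrow> (\<lambda>n. a n c) \<longlonglongrightarrow> l c" by blast
    have "s \<longlonglongrightarrow> (\<Sum>c\<in>B. l c *\<^sub>R c)"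
      unfolding s_def by (intro tendsto_intros l)
    then have "b = (\<Sum>c\<in>B. l c *\<^sub>R c)" using lim LIMSEQ_unique by blast
    then show False using b by (simp add: span_sum span_scale span_base)
  qed
  then obtain \<delta> where \<delta>: "\<delta> > 0" "\<And>a. \<delta> \<le> norm (b - (\<Sum>c\<in>B. a c *\<^sub>R c))" by blast
  let ?D = "\<bar>C\<bar> * (1 + norm b / \<delta>)"
  have "\<bar>a c\<bar> \<le> max (1 / \<delta>) ?D * norm (\<Sum>c\<in>insert b B. a c *\<^sub>R c)" if c: "c \<in> insert b B" for a c
  proof -
    define y where "y = (\<Sum>c\<in>B. a c *\<^sub>R c)"
    define x where "x = (\<Sum>c\<in>insert b B. a c *\<^sub>R c)"
    have x: "x = a b *\<^sub>R b + y" using insert.hyps by (simp add: x_def y_def)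
    have ab: "\<bar>a b\<bar> \<le> norm x / \<delta>"
    proof (cases "a b = 0")
      case False
      have "\<delta> \<le> norm (b - (\<Sum>c\<in>B. (- a c / a b) *\<^sub>R c))" by (rule \<delta>)
      also have "b - (\<Sum>c\<in>B. (- a c / a b) *\<^sub>R c) = (1 / a b) *\<^sub>R x"
        using False by (simp add: x y_def scaleR_add_right scaleR_sum_right sum_negf)
      finally show ?thesis using False \<delta> by (simp add: field_simps)
    qed (use \<delta> in simp)
    show ?thesis
    proof (cases "c = b")
      case True
      have "\<bar>a b\<bar> \<le> 1 / \<delta> * norm x" using ab by simp
      also have "\<dots> \<le> max (1 / \<delta>) ?D * norm x" by (intro mult_right_mono) auto
      finally show ?thesis using True by (simp add: x_def)
    next
      case False
      then have cB: "c \<in> B" using c by simp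
      have "norm y \<le> norm x + \<bar>a b\<bar> * norm b"
        using norm_triangle_ineq4[of x "a b *\<^sub>R b"] by (simp add: x)
      also have "\<dots> \<le> norm x + norm x / \<delta> * norm b"
        using ab by (intro add_left_mono mult_right_mono) auto
      also have "\<dots> = (1 + norm b / \<delta>) * norm x" by (simp add: field_simps)
      finally have ny: "norm y \<le> (1 + norm b / \<delta>) * norm x" .
      have "\<bar>a c\<bar> \<le> C * norm y" using C[OF cB, of a] by (simp add: y_def)
      also have "\<dots> \<le> \<bar>C\<bar> * norm y" by (intro mult_right_mono) auto
      also have "\<dots> \<le> \<bar>C\<bar> * ((1 + norm b / \<delta>) * norm x)" by (intro mult_left_mono ny) auto
      also have "\<dots> = ?D * norm x" by simp
      also have "\<dots> \<le> max (1 / \<delta>) ?D * norm x" by (intro mult_right_mono) auto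
      finally show ?thesis by (simp add: x_def)
    qed
  qed
  then show ?case by blast
qed

lemma bounded_coordinates:
  fixes S :: "'a::real_normed_vector set"
  assumes "finite S" "span S = UNIV"
  obtains B :: "'a set" and r :: "'a \<Rightarrow> 'a \<Rightarrow> real"
  where "finite B" "\<And>b. b \<in> B \<Longrightarrow> bounded_linear (r b)" "\<And>x. (\<Sum>b\<in>B. r b x *\<^sub>R b) = x"
proof -
  obtain B where B: "B \<subseteq> S" "independent B" "S \<subseteq> span B"
    using maximal_independent_subset[of S] by blast
  have fin: "finite B" using B(1) assms(1) finite_subset by blast
  have sp: "x \<in> span B" for x
    using assms(2) B(3) by (metis UNIV_I span_minimal subsetD subspace_span)
  have eq: "(\<Sum>b\<in>B. representation B x b *\<^sub>R b) = x" for x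
    using B(2) sp fin by (intro real_vector.sum_representation_eq) auto
  obtain C where C: "\<And>a b. b \<in> B \<Longrightarrow> \<bar>a b\<bar> \<le> C * norm (\<Sum>c\<in>B. a c *\<^sub>R c)"
    using independent_coefficients_bounded[OF fin B(2)] by blast
  have bl: "bounded_linear (\<lambda>x. representation B x b)" if "b \<in> B" for b
  proof (rule bounded_linear_intro[where K = C])
    fix x y :: 'a and c :: real
    show "representation B (x + y) b = representation B x b + representation B y b"
      using real_vector.representation_add[OF B(2) sp sp] by (simp add: fun_eq_iff)
    show "representation B (c *\<^sub>R x) b = c *\<^sub>R representation B x b"
      using real_vector.representation_scale[OF B(2) sp] by (simp add: fun_eq_iff)
    show "norm (representation B x b) \<le> norm x * C"
      using C[OF that, of "representation B x"] by (simp add: eq mult.commute)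
  qed
  show thesis by (rule that[of B "\<lambda>b x. representation B x b", OF fin bl eq])
qed

lemma finite_dim_linear_imp_bounded_linear:
  fixes f :: "'a::real_normed_vector \<Rightarrow> 'b::real_normed_vector"
  assumes "finite S" "span S = (UNIV :: 'a set)" "linear f"
  shows "bounded_linear f"
proof -
  obtain B :: "'a set" and r where B: "finite B" "\<And>b. b \<in> B \<Longrightarrow> bounded_linear (r b)"
    "\<And>x. (\<Sum>b\<in>B. r b x *\<^sub>R b) = x"
    using bounded_coordinates[OF assms(1,2)] by blast
  have "f = (\<lambda>x. \<Sum>b\<in>B. r b x *\<^sub>R f b)"
  proof
    fix x
    have "f x = f (\<Sum>b\<in>B. r b x *\<^sub>R b)" by (simp only: B(3))
    also have "\<dots> = (\<Sum>b\<in>B. r b x *\<^sub>R f b)"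
      using assms(3) by (simp add: linear_sum linear_scale)
    finally show "f x = (\<Sum>b\<in>B. r b x *\<^sub>R f b)" .
  qed
  moreover have "bounded_linear (\<lambda>x. \<Sum>b\<in>B. r b x *\<^sub>R f b)"
    by (intro bounded_linear_sum bounded_linear_scaleR_const B(2))
  ultimately show ?thesis by simp
qed

section \<open>Exponential series\<close>

text \<open>
  The exponential generating function of the sequence \<open>v\<close>. Differentiation shifts \<open>v\<close> by one, so
  both \<open>exp (- t ad\<^sub>A) X\<close> and its primitive \<open>t \<Z>(t ad\<^sub>A) X\<close> are covered: the first has
  \<open>v n = (- ad\<^sub>A)\<^sup>n X\<close>, the second the same sequence preceded by a zero.
\<close>

definition exp_series :: "(nat \<Rightarrow> 'a::real_normed_vector) \<Rightarrow> real \<Rightarrow> 'a" where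
  "exp_series v t = (\<Sum>n. (t ^ n / fact n) *\<^sub>R v n)"

definition geometric_growth :: "(nat \<Rightarrow> 'a::real_normed_vector) \<Rightarrow> bool" where
  "geometric_growth v \<longleftrightarrow> (\<exists>C K. \<forall>n. norm (v n) \<le> C * K ^ n)"

lemma geometric_growth_bounded_linear:
  assumes "geometric_growth v" "bounded_linear f"
  shows "geometric_growth (\<lambda>n. f (v n))"
proof -
  obtain C K where v: "\<And>n. norm (v n) \<le> C * K ^ n"
    using assms(1) by (auto simp: geometric_growth_def)
  obtain D where D: "D \<ge> 0" "\<And>x. norm (f x) \<le> norm x * D"
    using bounded_linear.nonneg_bounded[OF assms(2)] by blast
  have "norm (f (v n)) \<le> (C * D) * K ^ n" for n
  proof -
    have "norm (f (v n)) \<le> norm (v n) * D" by (rule D)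
    also have "\<dots> \<le> C * K ^ n * D" by (intro mult_right_mono v D)
    finally show ?thesis by (simp add: mult_ac)
  qed
  then show ?thesis unfolding geometric_growth_def by blast
qed

lemma geometric_growth_funpow:
  fixes L :: "'a::real_normed_vector \<Rightarrow> 'a"
  assumes "bounded_linear L"
  shows "geometric_growth (\<lambda>n. (L ^^ n) x)"
proof -
  obtain D where D: "D \<ge> 0" "\<And>x. norm (L x) \<le> norm x * D"
    using bounded_linear.nonneg_bounded[OF assms] by blast
  have "norm ((L ^^ n) x) \<le> norm x * D ^ n" for n
  proof (induction n)
    case (Suc n)
    have "norm ((L ^^ Suc n) x) \<le> norm ((L ^^ n) x) * D" using D(2)[of "(L ^^ n) x"] by simp
    also have "\<dots> \<le> norm x * D ^ n * D" by (intro mult_right_mono Suc D)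
    finally show ?case by (simp add: mult_ac)
  qed simp
  then show ?thesis unfolding geometric_growth_def by blast
qed

lemma geometric_growth_prepend_zero:
  assumes "geometric_growth v"
  shows "geometric_growth (case_nat 0 v)"
proof -
  obtain C K where v: "\<And>n. norm (v n) \<le> C * K ^ n"
    using assms by (auto simp: geometric_growth_def)
  have C: "0 \<le> C" using v[of 0] norm_ge_zero[of "v 0"] by (simp del: norm_ge_zero)
  have "norm (case_nat 0 v n) \<le> C * (1 + \<bar>K\<bar>) ^ n" for n
  proof (cases n)
    case 0
    then show ?thesis using C by simp
  next
    case (Suc m)
    have "norm (v m) \<le> C * \<bar>K\<bar> ^ m"
    proof -
      have "K ^ m \<le> \<bar>K\<bar> ^ m" by (metis abs_ge_self power_abs)
      then show ?thesis using v[of m] C by (meson mult_left_mono order_trans)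
    qed
    also have "\<dots> \<le> C * (1 + \<bar>K\<bar>) ^ m" by (intro mult_left_mono power_mono C) auto
    also have "\<dots> \<le> C * (1 + \<bar>K\<bar>) ^ Suc m" by (intro mult_left_mono power_increasing C) auto
    finally show ?thesis using Suc by simp
  qed
  then show ?thesis unfolding geometric_growth_def by blast
qed

lemma geometric_growth_summable_real:
  fixes v :: "nat \<Rightarrow> real"
  assumes "geometric_growth v"
  shows "summable (\<lambda>n. v n / fact n * t ^ n)"
proof -
  obtain C K where v: "\<And>n. norm (v n) \<le> C * K ^ n"
    using assms by (auto simp: geometric_growth_def)
  have "summable (\<lambda>n. C * (inverse (fact n) * (K * \<bar>t\<bar>) ^ n))"
    by (intro summable_mult summable_exp)
  then show ?thesis
  proof (rule summable_comparison_test')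
    fix n
    have "\<bar>v n\<bar> * (\<bar>t\<bar> ^ n / fact n) \<le> C * K ^ n * (\<bar>t\<bar> ^ n / fact n)"
      using v[of n] by (intro mult_right_mono) auto
    then show "norm (v n / fact n * t ^ n) \<le> C * (inverse (fact n) * (K * \<bar>t\<bar>) ^ n)"
      by (simp add: abs_mult power_abs power_mult_distrib field_simps)
  qed
qed

lemma exp_series_real_deriv:
  fixes v :: "nat \<Rightarrow> real"
  assumes "geometric_growth v"
  shows "(exp_series v has_real_derivative exp_series (\<lambda>n. v (Suc n)) t) (at t)"
proof -
  have "((\<lambda>t. \<Sum>n. v n / fact n * t ^ n) has_real_derivative
      (\<Sum>n. diffs (\<lambda>n. v n / fact n) n * t ^ n)) (at t)"
    by (rule termdiffs_strong_converges_everywhere) (rule geometric_growth_summable_real[OF assms])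
  moreover have "diffs (\<lambda>n. v n / fact n) n = v (Suc n) / fact n" for n
    by (simp add: diffs_def field_simps del: of_nat_Suc)
  ultimately show ?thesis by (simp add: exp_series_def[abs_def] mult.commute)
qed

text \<open>
  A finite-dimensional type need not be an instance of the class \<open>banach\<close>; passing to coordinates
  reduces convergence to that of real series.
\<close>

lemma exp_series_coordinates:
  fixes v :: "nat \<Rightarrow> 'a::real_normed_vector"
  assumes B: "finite B" "\<And>b. b \<in> B \<Longrightarrow> bounded_linear (r b)"
    and eq: "\<And>x. (\<Sum>b\<in>B. r b x *\<^sub>R b) = (x::'a)"
    and v: "geometric_growth v"
  shows "(\<lambda>n. (t ^ n / fact n) *\<^sub>R v n) sums (\<Sum>b\<in>B. exp_series (\<lambda>n. r b (v n)) t *\<^sub>R b)"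
proof -
  have "(\<lambda>n. ((t ^ n / fact n) *\<^sub>R r b (v n)) *\<^sub>R b) sums (exp_series (\<lambda>n. r b (v n)) t *\<^sub>R b)"
    if "b \<in> B" for b
  proof (rule sums_scaleR_left)
    show "(\<lambda>n. (t ^ n / fact n) *\<^sub>R r b (v n)) sums exp_series (\<lambda>n. r b (v n)) t"
      using geometric_growth_summable_real[OF geometric_growth_bounded_linear[OF v B(2)[OF that]], of t]
      by (simp add: exp_series_def summable_sums mult.commute)
  qed
  then have "(\<lambda>n. \<Sum>b\<in>B. ((t ^ n / fact n) *\<^sub>R r b (v n)) *\<^sub>R b) sums
      (\<Sum>b\<in>B. exp_series (\<lambda>n. r b (v n)) t *\<^sub>R b)"
    by (rule sums_sum)
  moreover have "(\<Sum>b\<in>B. ((t ^ n / fact n) *\<^sub>R r b (v n)) *\<^sub>R b) = (t ^ n / fact n) *\<^sub>R v n" for n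
    using arg_cong[OF eq[of "v n"], of "scaleR (t ^ n / fact n)"]
    by (simp add: scaleR_sum_right)
  ultimately show ?thesis by simp
qed

lemma exp_series_sums:
  fixes v :: "nat \<Rightarrow> 'a::real_normed_vector"
  assumes S: "finite S" "span S = (UNIV :: 'a set)" and v: "geometric_growth v"
  shows "(\<lambda>n. (t ^ n / fact n) *\<^sub>R v n) sums exp_series v t"
proof -
  obtain B :: "'a set" and r where "finite B" "\<And>b. b \<in> B \<Longrightarrow> bounded_linear (r b)"
    "\<And>x. (\<Sum>b\<in>B. r b x *\<^sub>R b) = x"
    using bounded_coordinates[OF S] by blast
  from exp_series_coordinates[OF this v, of t]
  show ?thesis unfolding exp_series_def using sums_iff by blast
qed

lemma exp_series_has_vector_derivative:
  fixes v :: "nat \<Rightarrow> 'a::real_normed_vector"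
  assumes S: "finite S" "span S = (UNIV :: 'a set)" and v: "geometric_growth v"
  shows "(exp_series v has_vector_derivative exp_series (\<lambda>n. v (Suc n)) t) (at t)"
proof -
  obtain B :: "'a set" and r where B: "finite B" "\<And>b. b \<in> B \<Longrightarrow> bounded_linear (r b)"
    "\<And>x. (\<Sum>b\<in>B. r b x *\<^sub>R b) = x"
    using bounded_coordinates[OF S] by blast
  obtain C K where CK: "\<And>n. norm (v n) \<le> C * K ^ n"
    using v by (auto simp: geometric_growth_def)
  have "norm (v (Suc n)) \<le> (C * K) * K ^ n" for n using CK[of "Suc n"] by (simp add: mult_ac)
  then have v': "geometric_growth (\<lambda>n. v (Suc n))" unfolding geometric_growth_def by blast
  have exp: "exp_series w = (\<lambda>t. \<Sum>b\<in>B. exp_series (\<lambda>n. r b (w n)) t *\<^sub>R b)"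
    if "geometric_growth w" for w
    using sums_unique[OF exp_series_coordinates[OF B that]] by (simp add: exp_series_def[of w] fun_eq_iff)
  have d: "((\<lambda>t. exp_series (\<lambda>n. r b (v n)) t *\<^sub>R b) has_vector_derivative
      exp_series (\<lambda>n. r b (v (Suc n))) t *\<^sub>R b) (at t)" if "b \<in> B" for b
  proof -
    have "(exp_series (\<lambda>n. r b (v n)) has_real_derivative exp_series (\<lambda>n. r b (v (Suc n))) t) (at t)"
      using exp_series_real_deriv[OF geometric_growth_bounded_linear[OF v B(2)[OF that]]] .
    from has_vector_derivative_scaleR[OF this has_vector_derivative_const[of b]]
    show ?thesis by simp
  qed
  have "((\<lambda>t. \<Sum>b\<in>B. exp_series (\<lambda>n. r b (v n)) t *\<^sub>R b) has_vector_derivative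
      (\<Sum>b\<in>B. exp_series (\<lambda>n. r b (v (Suc n))) t *\<^sub>R b)) (at t)"
    by (rule has_vector_derivative_sum[OF d])
  then show ?thesis by (simp add: exp[OF v] exp[OF v'])
qed

lemma exp_series_bounded_linear:
  fixes v :: "nat \<Rightarrow> 'a::real_normed_vector"
  assumes S: "finite S" "span S = (UNIV :: 'a set)" and v: "geometric_growth v"
    and f: "bounded_linear f"
  shows "f (exp_series v t) = exp_series (\<lambda>n. f (v n)) t"
proof -
  have "(\<lambda>n. (t ^ n / fact n) *\<^sub>R f (v n)) sums f (exp_series v t)"
    using bounded_linear.sums[OF f exp_series_sums[OF S v, of t]]
    by (simp add: linear_scale[OF bounded_linear.linear[OF f]])
  then show ?thesis by (simp add: exp_series_def sums_iff)
qed

lemma exp_series_0: "exp_series v 0 = v 0"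
proof -
  have "(\<lambda>n. (0 ^ n / fact n) *\<^sub>R v n) sums ((0 ^ 0 / fact 0) *\<^sub>R v 0)"
    using sums_finite[of "{0}" "\<lambda>n. (0 ^ n / fact n) *\<^sub>R v n"] by simp
  then show ?thesis by (simp add: exp_series_def sums_iff)
qed

section \<open>Uniqueness for linear differential equations\<close>

text \<open>
  The zero set of \<open>w\<close> is closed. It is also open: on a ball around a zero whose radius is at
  most \<open>1 / (2 K)\<close>, the mean value inequality bounds the maximum of \<open>norm w\<close> by half of itself.
\<close>

lemma linear_ode_zero:
  fixes w :: "real \<Rightarrow> 'b::real_normed_vector"
  assumes w': "\<And>t. (w has_vector_derivative w' t) (at t)"
    and K: "\<And>t. norm (w' t) \<le> K * norm (w t)"
    and w0: "w 0 = 0"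
  shows "w t = 0"
proof -
  have cont: "continuous_on A w" for A
    using w' by (meson continuous_at_imp_continuous_on has_vector_derivative_continuous)
  define h where "h = 1 / (2 * (\<bar>K\<bar> + 1))"
  have h: "h > 0" "\<bar>K\<bar> * h \<le> 1 / 2" by (simp_all add: h_def field_simps)
  define Z where "Z = {t. w t = 0}"
  have "closed Z"
    unfolding Z_def by (intro closed_Collect_eq cont continuous_on_const)
  moreover have "open Z"
    unfolding open_contains_ball
  proof
    fix s assume "s \<in> Z"
    then have s: "w s = 0" by (simp add: Z_def)
    obtain m where m: "m \<in> cball s h" "\<And>x. x \<in> cball s h \<Longrightarrow> norm (w x) \<le> norm (w m)"
      using continuous_attains_sup[of "cball s h" "\<lambda>x. norm (w x)"] h
        continuous_on_norm[OF cont] by auto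
    have "norm (w m - w s) \<le> (\<bar>K\<bar> * norm (w m)) * norm (m - s)"
    proof (rule differentiable_bound[of "cball s h" w "\<lambda>x u. u *\<^sub>R w' x"])
      fix x assume x: "x \<in> cball s h"
      show "(w has_derivative (\<lambda>u. u *\<^sub>R w' x)) (at x within cball s h)"
        using w' by (simp add: has_vector_derivative_def has_derivative_at_withinI)
      have "norm (w' x) \<le> K * norm (w x)" by (rule K)
      also have "\<dots> \<le> \<bar>K\<bar> * norm (w x)" by (intro mult_right_mono) auto
      also have "\<dots> \<le> \<bar>K\<bar> * norm (w m)" by (intro mult_left_mono m x) auto
      finally show "onorm (\<lambda>u. u *\<^sub>R w' x) \<le> \<bar>K\<bar> * norm (w m)"
        by (intro onorm_bound) (auto simp: mult_ac intro!: mult_left_mono)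
    qed (use m h in auto)
    also have "\<dots> \<le> (\<bar>K\<bar> * norm (w m)) * h"
      using m(1) by (intro mult_left_mono) (auto simp: dist_norm norm_minus_commute)
    also have "\<dots> = (\<bar>K\<bar> * h) * norm (w m)" by simp
    also have "\<dots> \<le> 1 / 2 * norm (w m)" by (intro mult_right_mono h) auto
    finally have "norm (w m) = 0" using s by simp
    then have "cball s h \<subseteq> Z" using m(2) by (auto simp: Z_def)
    then show "\<exists>e>0. ball s e \<subseteq> Z"
      using h ball_subset_cball[of s h] by blast
  qed
  ultimately have "Z = {} \<or> Z = UNIV" using clopen by blast
  then show ?thesis using w0 by (auto simp: Z_def)
qed

section \<open>Smooth functions\<close>

lemma Ck_on_const: "Ck_on k S (\<lambda>_. c)"
proof (induction k arbitrary: c)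
  case (Suc k)
  have "frechet_derivative (\<lambda>_. c) (at x) = (\<lambda>_. 0)" for x :: 'a
    by (rule frechet_derivative_at[symmetric]) simp
  then show ?case using Suc by simp
qed simp

text \<open>
  Openness is essential, as \<open>Ck_on\<close> refers to derivatives at the points of \<open>S\<close> in the whole space.
\<close>

lemma Ck_on_cong:
  assumes "open S" "\<And>x. x \<in> S \<Longrightarrow> f x = g x" "Ck_on k S f"
  shows "Ck_on k S g"
  using assms(2,3)
proof (induction k arbitrary: f g)
  case 0
  then show ?case by (simp cong: continuous_on_cong)
next
  case (Suc k)
  have der: "(g has_derivative frechet_derivative f (at x)) (at x)" if "x \<in> S" for x
  proof -
    have "(f has_derivative frechet_derivative f (at x)) (at x)"
      using Suc.prems(2) that by (simp add: frechet_derivative_works)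
    then show ?thesis
      using assms(1) that Suc.prems(1) by (rule has_derivative_transform_within_open)
  qed
  have "Ck_on k S (\<lambda>x. frechet_derivative g (at x) v)" for v
  proof (rule Suc.IH[rotated])
    show "Ck_on k S (\<lambda>x. frechet_derivative f (at x) v)" using Suc.prems(2) by simp
    show "frechet_derivative f (at x) v = frechet_derivative g (at x) v" if "x \<in> S" for x
      using frechet_derivative_at[OF der[OF that]] by simp
  qed
  moreover have "\<forall>x\<in>S. g differentiable (at x)" using der differentiableI by blast
  ultimately show ?case by simp
qed

lemma Ck_on_Suc_imp: "Ck_on (Suc k) S f \<Longrightarrow> Ck_on k S f"
proof (induction k arbitrary: f)
  case 0
  then show ?case
    by (auto intro!: continuous_at_imp_continuous_on differentiable_imp_continuous_within)
next
  case (Suc k)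
  have "Ck_on (Suc k) S (\<lambda>x. frechet_derivative f (at x) v)" for v
    using Suc.prems by simp
  then have "Ck_on k S (\<lambda>x. frechet_derivative f (at x) v)" for v by (rule Suc.IH)
  then show ?case using Suc.prems by simp
qed

lemma Ck_on_add:
  assumes "open S" "Ck_on k S f" "Ck_on k S g"
  shows "Ck_on k S (\<lambda>x. f x + g x)"
  using assms(2,3)
proof (induction k arbitrary: f g)
  case 0
  then show ?case by (simp add: continuous_on_add)
next
  case (Suc k)
  have der: "((\<lambda>x. f x + g x) has_derivative
      (\<lambda>v. frechet_derivative f (at x) v + frechet_derivative g (at x) v)) (at x)" if "x \<in> S" for x
    using Suc.prems that by (intro has_derivative_add) (simp_all add: frechet_derivative_works)
  have "Ck_on k S (\<lambda>x. frechet_derivative (\<lambda>x. f x + g x) (at x) v)" for v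
  proof (rule Ck_on_cong[OF assms(1)])
    show "Ck_on k S (\<lambda>x. frechet_derivative f (at x) v + frechet_derivative g (at x) v)"
      using Suc.prems by (intro Suc.IH) simp_all
  qed (simp flip: frechet_derivative_at[OF der])
  moreover have "\<forall>x\<in>S. (\<lambda>x. f x + g x) differentiable (at x)" using der differentiableI by blast
  ultimately show ?case by simp
qed

lemma Ck_on_mult:
  fixes f g :: "'a::real_normed_vector \<Rightarrow> real"
  assumes "open S" "Ck_on k S f" "Ck_on k S g"
  shows "Ck_on k S (\<lambda>x. f x * g x)"
  using assms(2,3)
proof (induction k arbitrary: f g)
  case 0
  then show ?case by (simp add: continuous_on_mult)
next
  case (Suc k)
  have der: "((\<lambda>x. f x * g x) has_derivative
      (\<lambda>v. f x * frechet_derivative g (at x) v + frechet_derivative f (at x) v * g x)) (at x)"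
    if "x \<in> S" for x
    using Suc.prems that by (intro has_derivative_mult) (simp_all add: frechet_derivative_works)
  have "Ck_on k S (\<lambda>x. frechet_derivative (\<lambda>x. f x * g x) (at x) v)" for v
  proof (rule Ck_on_cong[OF assms(1)])
    have "Ck_on k S f" "Ck_on k S g" using Suc.prems by (simp_all only: Ck_on_Suc_imp)
    then show "Ck_on k S (\<lambda>x. f x * frechet_derivative g (at x) v + frechet_derivative f (at x) v * g x)"
      using Suc.prems by (intro Ck_on_add[OF assms(1)] Suc.IH) simp_all
  qed (simp flip: frechet_derivative_at[OF der])
  moreover have "\<forall>x\<in>S. (\<lambda>x. f x * g x) differentiable (at x)" using der differentiableI by blast
  ultimately show ?case by simp
qed

section \<open>The Lie algebra\<close>

context
  fixes M :: "('g::{t2_space, second_countable_topology}, 'a::real_normed_vector, 'z) lie_data_scheme"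
  assumes lie: "lie_group M"
begin

lemma chart_image_open: "(W, \<phi>) \<in> atlas M \<Longrightarrow> open (\<phi> ` W)"
  using lie unfolding lie_group_def smooth_atlas_def by fast

lemma smooth_map_const: "smooth_map M (\<lambda>_. c)"
  by (auto simp: smooth_map_def smooth_on_def o_def Ck_on_const)

lemma smooth_map_add: "smooth_map M f \<Longrightarrow> smooth_map M h \<Longrightarrow> smooth_map M (\<lambda>g. f g + h g)"
  unfolding smooth_map_def smooth_on_def o_def
  using Ck_on_add[OF chart_image_open] by fast

lemma smooth_map_mult:
  fixes f h :: "'g \<Rightarrow> real"
  shows "smooth_map M f \<Longrightarrow> smooth_map M h \<Longrightarrow> smooth_map M (\<lambda>g. f g * h g)"
  unfolding smooth_map_def smooth_on_def o_def
  using Ck_on_mult[OF chart_image_open] by fast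

lemma smooth_map_diff:
  fixes f h :: "'g \<Rightarrow> real"
  assumes "smooth_map M f" "smooth_map M h"
  shows "smooth_map M (\<lambda>g. f g - h g)"
  using smooth_map_add[OF assms(1) smooth_map_mult[OF smooth_map_const[of "- 1"] assms(2)]] by simp

lemma livf_field: "livf M A \<in> left_invariant_fields M"
  using lie unfolding lie_group_def bij_betw_def by blast

lemma livf_inj: "livf M A = livf M B \<Longrightarrow> A = B"
  using lie unfolding lie_group_def bij_betw_def by (simp add: inj_eq)

lemma livf_surj:
  assumes "D \<in> left_invariant_fields M"
  shows "\<exists>A. livf M A = D"
proof -
  have "range (livf M) = left_invariant_fields M"
    using lie unfolding lie_group_def bij_betw_def by blast
  with assms have "D \<in> range (livf M)" by simp
  then show ?thesis by auto
qed

lemma livf_add: "livf M (A + B) f g = livf M A f g + livf M B f g"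
  using lie unfolding lie_group_def by blast

lemma livf_scaleR: "livf M (c *\<^sub>R A) f g = c * livf M A f g"
  using lie unfolding lie_group_def by blast

context
  fixes D assumes D: "D \<in> left_invariant_fields M"
begin

lemma field_smooth: "smooth_map M f \<Longrightarrow> smooth_map M (D f)"
  using D by (simp add: left_invariant_fields_def)

lemma field_not_smooth: "\<not> smooth_map M f \<Longrightarrow> D f = (\<lambda>_. 0)"
  using D by (simp add: left_invariant_fields_def)

lemma field_add:
  "smooth_map M f \<Longrightarrow> smooth_map M h \<Longrightarrow> D (\<lambda>x. f x + h x) = (\<lambda>x. D f x + D h x)"
  using D by (simp add: left_invariant_fields_def)

lemma field_scale: "smooth_map M f \<Longrightarrow> D (\<lambda>x. c * f x) = (\<lambda>x. c * D f x)"
  using D by (simp add: left_invariant_fields_def)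

lemma field_mult:
  "smooth_map M f \<Longrightarrow> smooth_map M h \<Longrightarrow> D (\<lambda>x. f x * h x) = (\<lambda>x. D f x * h x + f x * D h x)"
  using D by (simp add: left_invariant_fields_def)

lemma field_translate:
  "smooth_map M f \<Longrightarrow> D (\<lambda>x. f (g \<otimes>\<^bsub>M\<^esub> x)) = (\<lambda>x. D f (g \<otimes>\<^bsub>M\<^esub> x))"
  using D by (simp add: left_invariant_fields_def)

lemma field_const: "D (\<lambda>_. c) = (\<lambda>_. 0)"
proof -
  have "D (\<lambda>_. 1) = (\<lambda>x. D (\<lambda>_. 1) x + D (\<lambda>_. 1) x)"
    using field_mult[OF smooth_map_const[of 1] smooth_map_const[of 1]] by simp
  then have "D (\<lambda>_. 1) x = 0" for x by (auto dest: fun_cong[where x = x])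
  then show ?thesis using field_scale[OF smooth_map_const[of 1], of c] by simp
qed

end

text \<open>
  The usual computation: in the Leibniz rule the mixed terms \<open>D f * E h\<close> and \<open>E f * D h\<close> cancel.
\<close>

lemma commutator_field:
  assumes D: "D \<in> left_invariant_fields M" and E: "E \<in> left_invariant_fields M"
  shows "(\<lambda>f g. D (E f) g - E (D f) g) \<in> left_invariant_fields M"
  unfolding left_invariant_fields_def mem_Collect_eq
proof (intro conjI allI impI)
  note sm = field_smooth[OF D] field_smooth[OF E]
  fix f :: "'g \<Rightarrow> real" assume f: "smooth_map M f"
  show "smooth_map M (\<lambda>g. D (E f) g - E (D f) g)" by (intro smooth_map_diff sm f)
  show "(\<lambda>g. D (E (\<lambda>x. c * f x)) g - E (D (\<lambda>x. c * f x)) g) = (\<lambda>g. c * (D (E f) g - E (D f) g))" for c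
    by (simp add: field_scale[OF D] field_scale[OF E] sm f algebra_simps)
  show "(\<lambda>x. D (E (\<lambda>x. f (g \<otimes>\<^bsub>M\<^esub> x))) x - E (D (\<lambda>x. f (g \<otimes>\<^bsub>M\<^esub> x))) x) =
      (\<lambda>x. D (E f) (g \<otimes>\<^bsub>M\<^esub> x) - E (D f) (g \<otimes>\<^bsub>M\<^esub> x))" for g
    by (simp add: field_translate[OF D] field_translate[OF E] sm f)
  fix h :: "'g \<Rightarrow> real" assume h: "smooth_map M h"
  show "(\<lambda>g. D (E (\<lambda>x. f x + h x)) g - E (D (\<lambda>x. f x + h x)) g) =
      (\<lambda>g. D (E f) g - E (D f) g + (D (E h) g - E (D h) g))"
    by (simp add: field_add[OF D] field_add[OF E] sm f h algebra_simps)
  show "(\<lambda>g. D (E (\<lambda>x. f x * h x)) g - E (D (\<lambda>x. f x * h x)) g) =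
      (\<lambda>g. (D (E f) g - E (D f) g) * h g + f g * (D (E h) g - E (D h) g))"
    by (simp add: field_add[OF D] field_add[OF E] field_mult[OF D] field_mult[OF E]
        smooth_map_mult sm f h algebra_simps)
next
  fix f :: "'g \<Rightarrow> real" assume "\<not> smooth_map M f"
  then show "(\<lambda>g. D (E f) g - E (D f) g) = (\<lambda>_. 0)"
    using field_const[OF D, of 0] field_const[OF E, of 0]
    by (simp add: field_not_smooth[OF D] field_not_smooth[OF E])
qed

text \<open>
  Existence and uniqueness behind the definite description of the bracket: the commutator of two
  left-invariant fields is generated by exactly one vector. The algebraic properties of the bracket
  follow by comparing derivations.
\<close>

lemma livf_lie_bracket:
  "livf M (lie_bracket M A B) f = (\<lambda>g. livf M A (livf M B f) g - livf M B (livf M A f) g)"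
proof -
  obtain C where C: "livf M C = (\<lambda>f g. livf M A (livf M B f) g - livf M B (livf M A f) g)"
    using livf_surj[OF commutator_field[OF livf_field livf_field]] by blast
  have "lie_bracket M A B = C"
    unfolding lie_bracket_def
  proof (rule the_equality)
    fix C' assume "\<forall>f. livf M C' f = (\<lambda>g. livf M A (livf M B f) g - livf M B (livf M A f) g)"
    then show "C' = C" using C by (intro livf_inj) (simp add: fun_eq_iff)
  qed (simp add: C)
  then show ?thesis by (simp add: C)
qed

text \<open>
  Non-smooth functions contribute nothing, since every left-invariant derivation vanishes on them.
\<close>

lemma livf_eqI:
  assumes "\<And>f g. smooth_map M f \<Longrightarrow> livf M A f g = livf M B f g"
  shows "A = B"
proof (rule livf_inj, intro ext)
  show "livf M A f g = livf M B f g" for f g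
    using assms field_not_smooth[OF livf_field] by (cases "smooth_map M f") auto
qed

lemma linear_lie_bracket: "linear (lie_bracket M A)"
proof (rule linearI)
  show "lie_bracket M A (B + C) = lie_bracket M A B + lie_bracket M A C" for B C
  proof (rule livf_eqI)
    fix f :: "'g \<Rightarrow> real" and g assume f: "smooth_map M f"
    have "livf M (B + C) h = (\<lambda>x. livf M B h x + livf M C h x)" for h by (simp add: livf_add fun_eq_iff)
    then show "livf M (lie_bracket M A (B + C)) f g = livf M (lie_bracket M A B + lie_bracket M A C) f g"
      by (simp add: livf_lie_bracket livf_add field_add[OF livf_field] field_smooth[OF livf_field] f)
  qed
  show "lie_bracket M A (c *\<^sub>R B) = c *\<^sub>R lie_bracket M A B" for c B
  proof (rule livf_eqI)
    fix f :: "'g \<Rightarrow> real" and g assume f: "smooth_map M f"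
    have "livf M (c *\<^sub>R B) h = (\<lambda>x. c * livf M B h x)" for h by (simp add: livf_scaleR fun_eq_iff)
    then show "livf M (lie_bracket M A (c *\<^sub>R B)) f g = livf M (c *\<^sub>R lie_bracket M A B) f g"
      by (simp add: livf_lie_bracket livf_scaleR field_scale[OF livf_field] field_smooth[OF livf_field] f
          algebra_simps)
  qed
qed

lemma lie_bracket_antisym: "lie_bracket M A B = - lie_bracket M B A"
proof (rule livf_eqI)
  show "livf M (lie_bracket M A B) f g = livf M (- lie_bracket M B A) f g" for f g
    using livf_scaleR[of "- 1" "lie_bracket M B A" f g] by (simp add: livf_lie_bracket)
qed

text \<open>
  Evaluating at the translate of \<open>f\<close> by the inverse of \<open>g\<close> shows that the two tangent vectors at the
  identity agree, and a left-invariant field is determined by its value there. This turns equations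
  between tangent vectors along a geodesic into equations in the Lie algebra.
\<close>

lemma dL_inj:
  assumes "dL M g A = dL M g B"
  shows "A = B"
proof (rule livf_eqI)
  fix f :: "'g \<Rightarrow> real" and x assume f: "smooth_map M f"
  have G: "group M" "carrier M = UNIV" using lie by (simp_all add: lie_group_def)
  have one: "livf M A h \<one>\<^bsub>M\<^esub> = livf M B h \<one>\<^bsub>M\<^esub>" for h
  proof -
    have "inv\<^bsub>M\<^esub> g \<otimes>\<^bsub>M\<^esub> (g \<otimes>\<^bsub>M\<^esub> y) = y" for y
      using G by (metis UNIV_I group.inv_solve_left' group.inv_closed group.is_monoid monoid.m_closed)
    then show ?thesis
      using fun_cong[OF assms, of "\<lambda>y. h (inv\<^bsub>M\<^esub> g \<otimes>\<^bsub>M\<^esub> y)"] by (simp add: dL_def tangent_at_one_def)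
  qed
  have "livf M X f x = livf M X (\<lambda>y. f (x \<otimes>\<^bsub>M\<^esub> y)) \<one>\<^bsub>M\<^esub>" for X
    using field_translate[OF livf_field f, of X x] G by (simp add: group.is_monoid monoid.r_one)
  then show "livf M A f x = livf M B f x" by (simp add: one)
qed

lemma dL_zero: "dL M g 0 = (\<lambda>_. 0)"
  using livf_scaleR[of 0 0] by (simp add: dL_def tangent_at_one_def)

end

section \<open>The reductive decomposition\<close>

context
  fixes M :: "('g::{t2_space, second_countable_topology}, 'a::real_normed_vector, 'z) homogeneous_data_scheme"
  assumes nr: "naturally_reductive M"
begin

lemma lie: "lie_group M"
  using nr unfolding naturally_reductive_def by (elim conjE)

lemma subspace_iso: "subspace (isotropy_algebra M)"
  using nr unfolding naturally_reductive_def by (elim conjE)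

lemma subspace_hor: "subspace (hor M)"
  using nr unfolding naturally_reductive_def by (elim conjE)

lemma finite_spanning_set: "\<exists>S::'a set. finite S \<and> span S = UNIV"
  using lie by (simp add: lie_group_def)

lemma linear_imp_bounded_linear:
  fixes f :: "'a \<Rightarrow> 'b::real_normed_vector"
  assumes "linear f"
  shows "bounded_linear f"
  using finite_spanning_set finite_dim_linear_imp_bounded_linear assms by blast

text \<open>
  The definite description in \<open>hor_part\<close> is meaningful because the sum of the two subspaces is direct.
\<close>

lemma hor_part_eqI:
  assumes "Y \<in> hor M" "X - Y \<in> isotropy_algebra M"
  shows "hor_part M X = Y"
  unfolding hor_part_def
proof (rule the_equality)
  fix Y' assume Y': "Y' \<in> hor M \<and> X - Y' \<in> isotropy_algebra M"
  have "Y' - Y \<in> hor M" using Y' assms subspace_diff[OF subspace_hor] by blast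
  moreover have "Y' - Y \<in> isotropy_algebra M"
    using subspace_diff[OF subspace_iso assms(2), of "X - Y'"] Y' by simp
  moreover have "isotropy_algebra M \<inter> hor M = {0}"
    using nr unfolding naturally_reductive_def by (elim conjE)
  ultimately have "Y' - Y = 0" by blast
  then show "Y' = Y" by simp
qed (use assms in simp)

lemma hor_part_decomposition: "hor_part M X \<in> hor M \<and> X - hor_part M X \<in> isotropy_algebra M"
proof -
  have "\<forall>X. \<exists>Y\<in>isotropy_algebra M. \<exists>Z\<in>hor M. X = Y + Z"
    using nr unfolding naturally_reductive_def by (elim conjE)
  then obtain Y Z where YZ: "Y \<in> isotropy_algebra M" "Z \<in> hor M" "X = Y + Z" by blast
  then have "hor_part M X = Z" by (intro hor_part_eqI) simp_all
  then show ?thesis using YZ by simp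
qed

lemma hor_part_in [simp]: "hor_part M X \<in> hor M"
  using hor_part_decomposition by blast

lemma iso_part_eq: "iso_part M X = X - hor_part M X"
  unfolding iso_part_def
proof (rule the_equality)
  fix Y assume "Y \<in> isotropy_algebra M \<and> X - Y \<in> hor M"
  then have "hor_part M X = X - Y" by (intro hor_part_eqI) simp_all
  then show "Y = X - hor_part M X" by simp
qed (simp add: hor_part_decomposition)

lemma iso_part_in [simp]: "iso_part M X \<in> isotropy_algebra M"
  using hor_part_decomposition by (simp add: iso_part_eq)

lemma hor_part_hor: "X \<in> hor M \<Longrightarrow> hor_part M X = X"
  by (intro hor_part_eqI) (simp_all add: subspace_0[OF subspace_iso])

lemma hor_part_iso: "X \<in> isotropy_algebra M \<Longrightarrow> hor_part M X = 0"
  by (intro hor_part_eqI) (simp_all add: subspace_0[OF subspace_hor])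

lemma iso_part_hor: "X \<in> hor M \<Longrightarrow> iso_part M X = 0"
  by (simp add: iso_part_eq hor_part_hor)

lemma linear_hor_part: "linear (hor_part M)"
proof (rule linearI)
  show "hor_part M (X + Y) = hor_part M X + hor_part M Y" for X Y
    using subspace_add[OF subspace_iso iso_part_in[of X] iso_part_in[of Y]]
    by (intro hor_part_eqI subspace_add[OF subspace_hor]) (simp_all add: iso_part_eq algebra_simps)
  show "hor_part M (c *\<^sub>R X) = c *\<^sub>R hor_part M X" for c X
    using subspace_scale[OF subspace_iso iso_part_in[of X], of c]
    by (intro hor_part_eqI subspace_scale[OF subspace_hor]) (simp_all add: iso_part_eq algebra_simps)
qed

lemma linear_iso_part: "linear (iso_part M)"
  unfolding iso_part_eq[abs_def] by (intro linear_compose_sub linear_hor_part linear_ident)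

lemmas linear_br = linear_lie_bracket[OF lie]

lemma linear_hor_bracket: "linear (hor_bracket M A)"
  using linear_compose[OF linear_br linear_hor_part] by (simp add: hor_bracket_def[abs_def] o_def)

lemma hor_bracket_in [simp]: "hor_bracket M A X \<in> hor M"
  by (simp add: hor_bracket_def)

lemma hor_bracket_antisym: "hor_bracket M A X = - hor_bracket M X A"
  using lie_bracket_antisym[OF lie, of A X] linear_neg[OF linear_hor_part] by (simp add: hor_bracket_def)

lemma hor_bracket_self: "hor_bracket M A A = 0"
  using hor_bracket_antisym[of A A] by (simp add: eq_neg_iff_add_eq_0 flip: scaleR_2)

lemma bracket_iso_hor: "D \<in> isotropy_algebra M \<Longrightarrow> X \<in> hor M \<Longrightarrow> lie_bracket M D X \<in> hor M"
  using nr unfolding naturally_reductive_def by (elim conjE) blast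

lemma bracket_hor_iso: "D \<in> isotropy_algebra M \<Longrightarrow> X \<in> hor M \<Longrightarrow> lie_bracket M X D \<in> hor M"
  using bracket_iso_hor[of D X] subspace_neg[OF subspace_hor] lie_bracket_antisym[OF lie, of X D] by simp

lemma hor_part_bracket:
  assumes "A \<in> hor M"
  shows "hor_part M (lie_bracket M A X) =
    hor_bracket M A (hor_part M X) + lie_bracket M A (iso_part M X)"
proof -
  have "lie_bracket M A X = lie_bracket M A (hor_part M X) + lie_bracket M A (iso_part M X)"
    by (simp add: iso_part_eq flip: linear_add[OF linear_br])
  then show ?thesis
    using assms by (simp add: hor_bracket_def linear_add[OF linear_hor_part] hor_part_hor bracket_hor_iso)
qed

text \<open>
  Only the horizontal part of \<open>X\<close> contributes: the bracket of a horizontal with a vertical vector is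
  horizontal.
\<close>

lemma iso_part_bracket:
  assumes "A \<in> hor M"
  shows "iso_part M (lie_bracket M A X) = iso_part M (lie_bracket M A (hor_part M X))"
proof -
  have "lie_bracket M A X = lie_bracket M A (hor_part M X) + lie_bracket M A (iso_part M X)"
    by (simp add: iso_part_eq flip: linear_add[OF linear_br])
  then show ?thesis
    using assms
    by (simp add: linear_add[OF linear_iso_part] iso_part_eq[of "lie_bracket M A (iso_part M X)"]
        hor_part_hor bracket_hor_iso)
qed

lemma form_add: "X \<in> hor M \<Longrightarrow> Y \<in> hor M \<Longrightarrow> Z \<in> hor M \<Longrightarrow>
    form M (X + Y) Z = form M X Z + form M Y Z"
  using nr unfolding naturally_reductive_def by (elim conjE) blast

lemma form_scaleR: "X \<in> hor M \<Longrightarrow> Y \<in> hor M \<Longrightarrow> form M (c *\<^sub>R X) Y = c * form M X Y"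
  using nr unfolding naturally_reductive_def by (elim conjE) blast

lemma form_sym: "X \<in> hor M \<Longrightarrow> Y \<in> hor M \<Longrightarrow> form M X Y = form M Y X"
  using nr unfolding naturally_reductive_def by (elim conjE) blast

lemma form_pos: "X \<in> hor M \<Longrightarrow> X \<noteq> 0 \<Longrightarrow> form M X X > 0"
  using nr unfolding naturally_reductive_def by (elim conjE) blast

lemma form_hor_bracket: "X \<in> hor M \<Longrightarrow> Y \<in> hor M \<Longrightarrow> Z \<in> hor M \<Longrightarrow>
    form M (hor_bracket M Z X) Y = - form M X (hor_bracket M Z Y)"
proof -
  have "\<forall>X\<in>hor M. \<forall>Y\<in>hor M. \<forall>Z\<in>hor M.
      form M X (hor_bracket M Z Y) + form M (hor_bracket M Z X) Y = 0"
    using nr unfolding naturally_reductive_def by (elim conjE)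
  then show "X \<in> hor M \<Longrightarrow> Y \<in> hor M \<Longrightarrow> Z \<in> hor M \<Longrightarrow>
    form M (hor_bracket M Z X) Y = - form M X (hor_bracket M Z Y)" by (simp add: add_eq_0_iff)
qed

lemma form_diff: "X \<in> hor M \<Longrightarrow> Y \<in> hor M \<Longrightarrow> Z \<in> hor M \<Longrightarrow>
    form M (X - Y) Z = form M X Z - form M Y Z"
  using form_add[of X "(- 1) *\<^sub>R Y" Z] form_scaleR[of Y Z "- 1"] subspace_neg[OF subspace_hor] by simp

text \<open>
  With \<open>N\<close> for the horizontal bracket with \<open>A\<close>, skewness gives \<open>\<langle>N V, V\<rangle> = \<langle>N W, W\<rangle> = 0\<close>. In the
  sum of the two the terms with the imaginary part of \<open>\<mu>\<close> cancel, which leaves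
  \<open>Re \<mu> (\<langle>V, V\<rangle> + \<langle>W, W\<rangle>) = 0\<close>.
\<close>

lemma hor_bracket_eigenvalue_imaginary:
  assumes A: "A \<in> hor M" and V: "V \<in> hor M" and W: "W \<in> hor M"
    and eig: "complex_eigenvector (hor_bracket M A) \<mu> V W"
  shows "Re \<mu> = 0"
proof -
  let ?F = "form M"
  have VW: "(V, W) \<noteq> (0, 0)" and LV: "hor_bracket M A V = Re \<mu> *\<^sub>R V - Im \<mu> *\<^sub>R W"
    and LW: "hor_bracket M A W = Im \<mu> *\<^sub>R V + Re \<mu> *\<^sub>R W"
    using eig by (simp_all add: complex_eigenvector_def)
  have self: "?F (hor_bracket M A X) X = 0" if "X \<in> hor M" for X
    using form_hor_bracket[OF that that A] form_sym[of X "hor_bracket M A X"] that by simp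
  note sc = subspace_scale[OF subspace_hor]
  have "0 = ?F (Re \<mu> *\<^sub>R V - Im \<mu> *\<^sub>R W) V + ?F (Im \<mu> *\<^sub>R V + Re \<mu> *\<^sub>R W) W"
    using self[OF V] self[OF W] by (simp add: LV LW)
  also have "\<dots> = Re \<mu> * (?F V V + ?F W W)"
    using V W by (simp add: form_diff form_add form_scaleR sc form_sym[of W V] algebra_simps)
  finally have "Re \<mu> * (?F V V + ?F W W) = 0" by simp
  moreover have "?F V V \<ge> 0" "?F W W \<ge> 0" "?F V V + ?F W W \<noteq> 0"
  proof -
    have zero: "?F 0 0 = 0" using form_scaleR[of 0 0 0] subspace_0[OF subspace_hor] by simp
    show "?F V V \<ge> 0" "?F W W \<ge> 0"
      using form_pos[OF V] form_pos[OF W] zero by (cases "V = 0"; cases "W = 0"; force)+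
    show "?F V V + ?F W W \<noteq> 0"
      using form_pos[OF V] form_pos[OF W] zero VW by (cases "V = 0"; cases "W = 0"; force)
  qed
  ultimately show ?thesis by simp
qed

lemma linear_has_vector_derivative:
  fixes f :: "'a \<Rightarrow> 'a"
  shows "linear f \<Longrightarrow> (y has_vector_derivative y') (at t) \<Longrightarrow>
    ((\<lambda>t. f (y t)) has_vector_derivative f y') (at t)"
  by (rule bounded_linear.has_vector_derivative[OF linear_imp_bounded_linear])

text \<open>
  The linear map \<open>iso_part\<close> vanishes along the curve, hence also on its velocity.
\<close>

lemma derivative_in_hor:
  assumes "\<And>t. y t \<in> hor M" "(y has_vector_derivative y') (at t)"
  shows "y' \<in> hor M"
proof -
  have "((\<lambda>t. iso_part M (y t)) has_vector_derivative iso_part M y') (at t)"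
    by (rule linear_has_vector_derivative[OF linear_iso_part assms(2)])
  moreover have "iso_part M (y t) = 0" for t by (simp add: iso_part_eq hor_part_hor assms(1))
  ultimately have "((\<lambda>_. 0) has_vector_derivative iso_part M y') (at t)" by simp
  then have "iso_part M y' = 0"
    using vector_derivative_unique_at has_vector_derivative_const by blast
  then show ?thesis using hor_part_in[of y'] by (simp add: iso_part_eq)
qed

section \<open>The connection on left-invariant fields\<close>

text \<open>
  The term that remains of the curvature when the Jacobi equation is written with ordinary
  derivatives in the left trivialisation; the terms quadratic in the horizontal bracket cancel,
  and the equation reads \<open>y'' + [A, y']_b = [A, [A, y]_k]\<close>.
\<close>

definition jacobi_operator :: "'a \<Rightarrow> 'a \<Rightarrow> 'a" where
  "jacobi_operator A X = lie_bracket M A (iso_part M (lie_bracket M A X))"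

lemma linear_jacobi_operator: "linear (jacobi_operator A)"
  using linear_compose[OF linear_compose[OF linear_br linear_iso_part] linear_br]
  by (simp add: jacobi_operator_def[abs_def] o_def)

context
  fixes nabla :: "('g \<Rightarrow> 'a) \<Rightarrow> ('g \<Rightarrow> 'a) \<Rightarrow> ('g \<Rightarrow> 'a)"
  assumes lc: "lifted_levi_civita M nabla"
begin

lemma smooth_const: "smooth_map M (\<lambda>_. c)"
  by (rule smooth_map_const[OF lie])

lemma horizontal_const: "Y \<in> hor M \<Longrightarrow> horizontal_field M (\<lambda>_. Y)"
  by (simp add: horizontal_field_def smooth_const)

lemma nabla_const_in: "Y \<in> hor M \<Longrightarrow> nabla (\<lambda>_. X) (\<lambda>_. Y) g \<in> hor M"
proof -
  have "\<forall>S Y. smooth_map M S \<longrightarrow> horizontal_field M Y \<longrightarrow> horizontal_field M (nabla S Y)"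
    using lc unfolding lifted_levi_civita_def by (elim conjE)
  then show "Y \<in> hor M \<Longrightarrow> nabla (\<lambda>_. X) (\<lambda>_. Y) g \<in> hor M"
    using smooth_const horizontal_const unfolding horizontal_field_def by blast
qed

lemma nabla_const_add:
  assumes "Y \<in> hor M"
  shows "nabla (\<lambda>_. X + X') (\<lambda>_. Y) g = nabla (\<lambda>_. X) (\<lambda>_. Y) g + nabla (\<lambda>_. X') (\<lambda>_. Y) g"
proof -
  have *: "\<forall>S T Y. smooth_map M S \<longrightarrow> smooth_map M T \<longrightarrow> horizontal_field M Y \<longrightarrow>
        nabla (\<lambda>g. S g + T g) Y = (\<lambda>g. nabla S Y g + nabla T Y g)"
    using lc unfolding lifted_levi_civita_def by (elim conjE)
  show ?thesis
    using *[rule_format, OF smooth_const[of X] smooth_const[of X'] horizontal_const[OF assms]] by simp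
qed

lemma nabla_const_zero: "nabla (\<lambda>_. X) (\<lambda>_. 0) g = 0"
proof -
  have *: "\<forall>S Y Z. smooth_map M S \<longrightarrow> horizontal_field M Y \<longrightarrow> horizontal_field M Z \<longrightarrow>
        nabla S (\<lambda>g. Y g + Z g) = (\<lambda>g. nabla S Y g + nabla S Z g)"
    using lc unfolding lifted_levi_civita_def by (elim conjE)
  have h0: "horizontal_field M (\<lambda>_. 0)" by (rule horizontal_const[OF subspace_0[OF subspace_hor]])
  show ?thesis
    using fun_cong[OF *[rule_format, OF smooth_const[of X] h0 h0], of g] by simp
qed

lemma nabla_const_metric:
  assumes "Y \<in> hor M" "Z \<in> hor M"
  shows "form M (nabla (\<lambda>_. X) (\<lambda>_. Y) g) Z = - form M Y (nabla (\<lambda>_. X) (\<lambda>_. Z) g)"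
proof -
  have *: "\<forall>S Y Z. smooth_map M S \<longrightarrow> horizontal_field M Y \<longrightarrow> horizontal_field M Z \<longrightarrow>
        field_deriv M S (\<lambda>g. form M (Y g) (Z g)) =
        (\<lambda>g. form M (nabla S Y g) (Z g) + form M (Y g) (nabla S Z g))"
    using lc unfolding lifted_levi_civita_def by (elim conjE)
  show ?thesis
    using fun_cong[OF *[rule_format, OF smooth_const[of X] horizontal_const[OF assms(1)]
          horizontal_const[OF assms(2)]], of g]
    by (simp add: field_deriv_def field_const[OF lie livf_field[OF lie]] add_eq_0_iff)
qed

lemma nabla_const_torsion:
  "nabla (\<lambda>_. X) (\<lambda>_. hor_part M Y) g - nabla (\<lambda>_. Y) (\<lambda>_. hor_part M X) g = hor_bracket M X Y"
proof -
  have *: "\<forall>S T R. smooth_map M S \<longrightarrow> smooth_map M T \<longrightarrow> smooth_map M R \<longrightarrow>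
        (\<forall>f::'g \<Rightarrow> real. smooth_map M f \<longrightarrow> field_deriv M R f =
           (\<lambda>g. field_deriv M S (field_deriv M T f) g - field_deriv M T (field_deriv M S f) g)) \<longrightarrow>
        (\<forall>g. nabla S (\<lambda>x. hor_part M (T x)) g - nabla T (\<lambda>x. hor_part M (S x)) g = hor_part M (R g))"
    using lc unfolding lifted_levi_civita_def by (elim conjE)
  show ?thesis
    unfolding hor_bracket_def
    by (rule *[rule_format, OF smooth_const[of X] smooth_const[of Y] smooth_const])
      (simp add: field_deriv_def livf_lie_bracket[OF lie])
qed

text \<open>
  Both sides are metric and have the same torsion; for the right-hand side, metric compatibility is
  natural reductivity. Their difference \<open>T\<close> is therefore symmetric, while \<open>\<langle>T X Y, Z\<rangle>\<close> is
  skew in \<open>Y\<close> and \<open>Z\<close>. Exchanging arguments three times shows that such a tensor equals its own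
  negative.
\<close>

lemma nabla_hor:
  assumes X: "X \<in> hor M" and Y: "Y \<in> hor M"
  shows "nabla (\<lambda>_. X) (\<lambda>_. Y) g = (1 / 2) *\<^sub>R hor_bracket M X Y"
proof -
  define T where "T X Y = nabla (\<lambda>_. X) (\<lambda>_. Y) g - (1 / 2) *\<^sub>R hor_bracket M X Y" for X Y
  have half: "(1 / 2) *\<^sub>R hor_bracket M X Y \<in> hor M" for X Y
    by (simp add: subspace_scale[OF subspace_hor])
  have T_in: "T X Y \<in> hor M" if "Y \<in> hor M" for X Y
    unfolding T_def by (intro subspace_diff[OF subspace_hor] nabla_const_in that half)
  have T_sym: "T X Y = T Y X" if "X \<in> hor M" "Y \<in> hor M" for X Y
  proof -
    have "hor_bracket M X Y = (1 / 2) *\<^sub>R hor_bracket M X Y - (1 / 2) *\<^sub>R hor_bracket M Y X"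
      by (simp add: hor_bracket_antisym[of Y X] flip: scaleR_add_left)
    then show ?thesis
      using nabla_const_torsion[of X Y g] that by (simp add: T_def hor_part_hor algebra_simps)
  qed
  have T_skew: "form M (T X Y) Z = - form M (T X Z) Y" if "X \<in> hor M" "Y \<in> hor M" "Z \<in> hor M" for X Y Z
  proof -
    have "form M (T X U) W = form M (nabla (\<lambda>_. X) (\<lambda>_. U) g) W - (1 / 2) * form M (hor_bracket M X U) W"
      if "U \<in> hor M" "W \<in> hor M" for U W
      using that by (simp add: T_def form_diff form_scaleR half nabla_const_in)
    then show ?thesis
      using that nabla_const_metric[of Y Z X g] form_hor_bracket[of Y Z X]
        form_sym[of Y "nabla (\<lambda>_. X) (\<lambda>_. Z) g"] form_sym[of Y "hor_bracket M X Z"]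
      by (simp add: nabla_const_in)
  qed
  have "form M (T X Y) Z = 0" if Z: "Z \<in> hor M" for Z
  proof -
    have "form M (T X Y) Z = - form M (T Z X) Y" using T_skew[OF X Y Z] T_sym[OF X Z] by simp
    also have "\<dots> = form M (T Y Z) X" using T_skew[OF Z X Y] T_sym[OF Z Y] by simp
    also have "\<dots> = - form M (T X Y) Z" using T_skew[OF Y Z X] T_sym[OF Y X] by simp
    finally show ?thesis by simp
  qed
  then have "T X Y = 0" using form_pos[OF T_in[OF Y]] T_in[OF Y] by (metis less_irrefl)
  then show ?thesis by (simp add: T_def)
qed

text \<open>
  The torsion equation with a vertical first argument: the horizontal part of \<open>D\<close> is zero, so only one
  of the two covariant derivatives survives.
\<close>

lemma nabla_iso:
  assumes "D \<in> isotropy_algebra M" "Y \<in> hor M"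
  shows "nabla (\<lambda>_. D) (\<lambda>_. Y) g = lie_bracket M D Y"
  using nabla_const_torsion[of D Y g] assms
  by (simp add: hor_part_hor hor_part_iso nabla_const_zero hor_bracket_def bracket_iso_hor)

text \<open>
  Write \<open>N\<close> for the horizontal bracket with \<open>A\<close>. The derivative of \<open>A\<close> in its own direction vanishes;
  the other second derivative contributes \<open>1/4 N\<^sup>2 X\<close>, the horizontal part of \<open>[X, A]\<close> contributes
  \<open>- 1/2 N\<^sup>2 X\<close>, and its vertical part the negative of the Jacobi operator.
\<close>

lemma lifted_curvature_eq:
  assumes A: "A \<in> hor M" and X: "X \<in> hor M"
  shows "lifted_curvature M nabla g X A A =
    - (1 / 4) *\<^sub>R hor_bracket M A (hor_bracket M A X) - jacobi_operator A X"
proof -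
  let ?N = "hor_bracket M A"
  have XA: "hor_bracket M X A = - ?N X" by (rule hor_bracket_antisym)
  have 1: "nabla (\<lambda>_. A) (\<lambda>_. A) = (\<lambda>_. 0)"
    using nabla_hor[OF A A] by (simp add: fun_eq_iff hor_bracket_self)
  have "nabla (\<lambda>_. X) (\<lambda>_. A) = (\<lambda>_. - (1 / 2) *\<^sub>R ?N X)"
    using nabla_hor[OF X A] by (simp add: fun_eq_iff XA)
  then have 2: "nabla (\<lambda>_. A) (nabla (\<lambda>_. X) (\<lambda>_. A)) g = - (1 / 4) *\<^sub>R ?N (?N X)"
    using nabla_hor[OF A, of "- (1 / 2) *\<^sub>R ?N X" g] subspace_scale[OF subspace_hor hor_bracket_in, of "- (1 / 2)" A X]
    by (simp add: linear_neg[OF linear_hor_bracket] linear_scale[OF linear_hor_bracket])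
  have 3: "nabla (\<lambda>_. lie_bracket M X A) (\<lambda>_. A) g = (1 / 2) *\<^sub>R ?N (?N X) + jacobi_operator A X"
  proof -
    have "lie_bracket M X A = hor_bracket M X A + iso_part M (lie_bracket M X A)"
      by (simp add: iso_part_eq hor_bracket_def)
    then have "nabla (\<lambda>_. lie_bracket M X A) (\<lambda>_. A) g =
        nabla (\<lambda>_. hor_bracket M X A) (\<lambda>_. A) g + nabla (\<lambda>_. iso_part M (lie_bracket M X A)) (\<lambda>_. A) g"
      using nabla_const_add[OF A] by metis
    also have "nabla (\<lambda>_. hor_bracket M X A) (\<lambda>_. A) g = (1 / 2) *\<^sub>R ?N (?N X)"
      using nabla_hor[OF hor_bracket_in A, of X A g] hor_bracket_antisym[of "- ?N X" A]
      by (simp add: XA linear_neg[OF linear_hor_bracket])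
    also have "nabla (\<lambda>_. iso_part M (lie_bracket M X A)) (\<lambda>_. A) g = jacobi_operator A X"
      unfolding nabla_iso[OF iso_part_in A]
      by (simp add: jacobi_operator_def lie_bracket_antisym[OF lie, of X A]
          lie_bracket_antisym[OF lie, of "- iso_part M (lie_bracket M A X)" A]
          linear_neg[OF linear_iso_part] linear_neg[OF linear_br])
    finally show ?thesis .
  qed
  show ?thesis
    unfolding lifted_curvature_def 1 2 3 nabla_const_zero
    by (simp add: algebra_simps flip: scaleR_add_left)
qed

section \<open>The Jacobi equation\<close>

lemma cov_deriv_eq:
  assumes "A \<in> hor M" "y t \<in> hor M" "(y has_vector_derivative y') (at t)"
  shows "cov_deriv M nabla U A y t = y' + (1 / 2) *\<^sub>R hor_bracket M A (y t)"
  unfolding cov_deriv_def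
  using nabla_hor[OF assms(1,2)] vector_derivative_at[OF assms(3)] by simp

text \<open>
  In the left trivialisation the covariant derivative is \<open>d/dt + N/2\<close>, with \<open>N\<close> the horizontal bracket
  with \<open>A\<close>. Its square is \<open>d\<^sup>2/dt\<^sup>2 + N d/dt + N\<^sup>2/4\<close>, and the last term cancels against the curvature.
\<close>

lemma jacobi_solutionI:
  assumes A: "A \<in> hor M"
    and y: "\<And>t. y t \<in> hor M" "\<And>t. (y has_vector_derivative y' t) (at t)"
    and y': "\<And>t. (y' has_vector_derivative
        - hor_bracket M A (y' t) + jacobi_operator A (y t)) (at t)"
    and init: "y 0 = C" "y' 0 + (1 / 2) *\<^sub>R hor_bracket M A C = E"
  shows "jacobi_solution M nabla U C A E y"
proof -
  let ?N = "hor_bracket M A"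
  have y'_in: "y' t \<in> hor M" for t by (rule derivative_in_hor[OF y])
  have cov: "cov_deriv M nabla U A y = (\<lambda>t. y' t + (1 / 2) *\<^sub>R ?N (y t))"
    using cov_deriv_eq[OF A y] by (simp add: fun_eq_iff)
  have cov_in: "y' t + (1 / 2) *\<^sub>R ?N (y t) \<in> hor M" for t
    by (intro subspace_add[OF subspace_hor] y'_in subspace_scale[OF subspace_hor]) simp
  have cov': "((\<lambda>t. y' t + (1 / 2) *\<^sub>R ?N (y t)) has_vector_derivative
      (- ?N (y' t) + jacobi_operator A (y t)) + (1 / 2) *\<^sub>R ?N (y' t)) (at t)" for t
    by (rule has_vector_derivative_add[OF y'
          linear_has_vector_derivative[OF linear_compose_scale_right[OF linear_hor_bracket] y(2)]])
  have "cov_deriv M nabla U A (cov_deriv M nabla U A y) t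
      + lifted_curvature M nabla (geodesic_lift M U A t) (y t) A A = 0" for t
    unfolding cov cov_deriv_eq[OF A cov_in cov'] lifted_curvature_eq[OF A y(1)]
    by (simp add: linear_add[OF linear_hor_bracket] linear_scale[OF linear_hor_bracket]
        flip: scaleR_2) (simp add: algebra_simps flip: scaleR_add_left)
  then show ?thesis
    unfolding jacobi_solution_def cov
    using y init differentiableI_vector[OF y(2)] differentiableI_vector[OF cov'] by auto
qed

lemma jacobi_solution_system:
  assumes A: "A \<in> hor M" and sol: "jacobi_solution M nabla U C A E y"
  defines "u \<equiv> cov_deriv M nabla U A y"
  shows "(y has_vector_derivative u t - (1 / 2) *\<^sub>R hor_bracket M A (y t)) (at t)"
    and "(u has_vector_derivative - (1 / 2) *\<^sub>R hor_bracket M A (u t)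
      + (1 / 4) *\<^sub>R hor_bracket M A (hor_bracket M A (y t)) + jacobi_operator A (y t)) (at t)"
proof -
  have y: "y t \<in> hor M" "y differentiable (at t)" "u differentiable (at t)"
    and eq: "cov_deriv M nabla U A u t
      + lifted_curvature M nabla (geodesic_lift M U A t) (y t) A A = 0" for t
    using sol by (simp_all add: jacobi_solution_def u_def)
  have yd: "(y has_vector_derivative vector_derivative y (at t)) (at t)" for t
    using y(2) by (simp add: vector_derivative_works)
  have ud: "(u has_vector_derivative vector_derivative u (at t)) (at t)" for t
    using y(3) by (simp add: vector_derivative_works)
  have u: "u t = vector_derivative y (at t) + (1 / 2) *\<^sub>R hor_bracket M A (y t)" for t
    unfolding u_def by (rule cov_deriv_eq[OF A y(1) yd])
  have u_in: "u t \<in> hor M" for t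
    unfolding u
    by (intro subspace_add[OF subspace_hor] derivative_in_hor[OF y(1) yd] subspace_scale[OF subspace_hor]) simp
  show "(y has_vector_derivative u t - (1 / 2) *\<^sub>R hor_bracket M A (y t)) (at t)"
    using yd by (simp add: u)
  have "vector_derivative u (at t) = - (1 / 2) *\<^sub>R hor_bracket M A (u t)
      + (1 / 4) *\<^sub>R hor_bracket M A (hor_bracket M A (y t)) + jacobi_operator A (y t)"
    using eq[of t] unfolding cov_deriv_eq[OF A u_in ud] lifted_curvature_eq[OF A y(1)]
    by (simp add: algebra_simps add_eq_0_iff)
  then show "(u has_vector_derivative - (1 / 2) *\<^sub>R hor_bracket M A (u t)
      + (1 / 4) *\<^sub>R hor_bracket M A (hor_bracket M A (y t)) + jacobi_operator A (y t)) (at t)"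
    using ud[of t] by simp
qed

text \<open>
  The pair of a solution and its covariant derivative satisfies a first-order linear system with
  constant coefficients \<open>\<Lambda>\<close>, even though nothing is known beforehand about the second derivative
  of the solution.
\<close>

lemma jacobi_solution_unique:
  assumes A: "A \<in> hor M"
    and sol: "jacobi_solution M nabla U C A E y" "jacobi_solution M nabla U C A E z"
  shows "y = z"
proof
  fix t
  define u where "u = cov_deriv M nabla U A y"
  define v where "v = cov_deriv M nabla U A z"
  let ?N = "hor_bracket M A"
  define \<Lambda> where "\<Lambda> = (\<lambda>p::'a \<times> 'a. (snd p - (1 / 2) *\<^sub>R ?N (fst p),
    - (1 / 2) *\<^sub>R ?N (snd p) + (1 / 4) *\<^sub>R ?N (?N (fst p)) + jacobi_operator A (fst p)))"
  have NN: "linear (\<lambda>x. ?N (?N x))"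
    using linear_compose[OF linear_hor_bracket linear_hor_bracket] by (simp add: o_def)
  note bl = linear_hor_bracket[THEN linear_imp_bounded_linear] NN[THEN linear_imp_bounded_linear]
    linear_jacobi_operator[THEN linear_imp_bounded_linear]
  have "bounded_linear \<Lambda>"
    unfolding \<Lambda>_def
    by (intro bounded_linear_Pair bounded_linear_sub bounded_linear_add bounded_linear_snd
        bounded_linear_const_scaleR bounded_linear_compose[OF bl(1)] bounded_linear_fst
        bounded_linear_compose[OF bl(2)] bounded_linear_compose[OF bl(3)])
  then obtain K where K: "\<And>p. norm (\<Lambda> p) \<le> norm p * K"
    using bounded_linear.bounded by blast
  define w where "w t = (y t - z t, u t - v t)" for t
  have "(w has_vector_derivative \<Lambda> (w t)) (at t)" for t
  proof -
    have "\<Lambda> (w t) = \<Lambda> (y t, u t) - \<Lambda> (z t, v t)"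
      using linear_diff[OF bounded_linear.linear[OF \<open>bounded_linear \<Lambda>\<close>], of "(y t, u t)" "(z t, v t)"]
      by (simp add: w_def)
    moreover have "((\<lambda>t. (y t, u t)) has_vector_derivative \<Lambda> (y t, u t)) (at t)"
      unfolding \<Lambda>_def fst_conv snd_conv u_def
      by (intro has_vector_derivative_Pair jacobi_solution_system[OF A sol(1)])
    moreover have "((\<lambda>t. (z t, v t)) has_vector_derivative \<Lambda> (z t, v t)) (at t)"
      unfolding \<Lambda>_def fst_conv snd_conv v_def
      by (intro has_vector_derivative_Pair jacobi_solution_system[OF A sol(2)])
    ultimately show ?thesis
      using has_vector_derivative_diff by (fastforce simp: w_def[abs_def])
  qed
  moreover have "norm (\<Lambda> (w t)) \<le> K * norm (w t)" for t using K[of "w t"] by (simp add: mult.commute)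
  moreover have "w 0 = 0" using sol by (simp add: w_def u_def v_def jacobi_solution_def zero_prod_def)
  ultimately have "w t = 0" by (rule linear_ode_zero)
  then show "y t = z t" by (simp add: w_def zero_prod_def)
qed


end

section \<open>Solutions of the Jacobi equation by exponential series\<close>

lemma exp_ad_eq_exp_series:
  "exp_ad M (- t) A X = exp_series (\<lambda>n. (- 1) ^ n *\<^sub>R (lie_bracket M A ^^ n) X) t"
  unfolding exp_ad_def exp_series_def
  by (intro arg_cong[of _ _ suminf] ext) (simp add: power_minus[of t])

lemma alternating_powers_eq:
  "(- 1) ^ n *\<^sub>R (lie_bracket M A ^^ n) X = ((\<lambda>Y. - lie_bracket M A Y) ^^ n) X"
proof (induction n)
  case (Suc n)
  show ?case
    by (simp flip: Suc add: linear_neg[OF linear_br] linear_scale[OF linear_br])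
qed simp

lemma linear_neg_br: "linear (\<lambda>Y. - lie_bracket M A Y)"
  by (rule linear_compose_neg[OF linear_br])

lemma alternating_powers_growth:
  "geometric_growth (\<lambda>n. (- 1) ^ n *\<^sub>R (lie_bracket M A ^^ n) X)"
  unfolding alternating_powers_eq by (rule geometric_growth_funpow[OF linear_imp_bounded_linear[OF linear_neg_br]])

lemma exp_ad_0: "exp_ad M 0 A X = X"
  using exp_ad_eq_exp_series[of 0 A X] by (simp add: exp_series_0)

lemma exp_ad_has_vector_derivative:
  "((\<lambda>t. exp_ad M (- t) A X) has_vector_derivative - lie_bracket M A (exp_ad M (- t) A X)) (at t)"
proof -
  obtain S :: "'a set" where S: "finite S" "span S = UNIV" using finite_spanning_set by blast
  let ?v = "\<lambda>n. (- 1) ^ n *\<^sub>R (lie_bracket M A ^^ n) X"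
  have "- lie_bracket M A (exp_series ?v t) = exp_series (\<lambda>n. - lie_bracket M A (?v n)) t"
    by (rule exp_series_bounded_linear[OF S alternating_powers_growth linear_imp_bounded_linear[OF linear_neg_br]])
  also have "(\<lambda>n. - lie_bracket M A (?v n)) = (\<lambda>n. ?v (Suc n))"
    by (simp add: linear_neg[OF linear_br] linear_scale[OF linear_br])
  finally show ?thesis
    using exp_series_has_vector_derivative[OF S alternating_powers_growth, of A X t]
    by (simp add: exp_ad_eq_exp_series)
qed

lemma scaled_Z_ad_eq_exp_series:
  "t *\<^sub>R Z_ad M t A X = exp_series (case_nat 0 (\<lambda>n. (- 1) ^ n *\<^sub>R (lie_bracket M A ^^ n) X)) t"
proof (cases "t = 0")
  case False
  obtain S :: "'a set" where S: "finite S" "span S = UNIV" using finite_spanning_set by blast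
  let ?v = "\<lambda>n. (- 1) ^ n *\<^sub>R (lie_bracket M A ^^ n) X"
  let ?s = "exp_series (case_nat 0 ?v) t"
  have "(\<lambda>n. (t ^ n / fact n) *\<^sub>R case_nat 0 ?v n) sums ?s"
    by (rule exp_series_sums[OF S geometric_growth_prepend_zero[OF alternating_powers_growth]])
  then have "(\<lambda>n. (t ^ Suc n / fact (Suc n)) *\<^sub>R ?v n) sums ?s"
    using sums_Suc_iff[of "\<lambda>n. (t ^ n / fact n) *\<^sub>R case_nat 0 ?v n" ?s]
    by (simp del: fact_Suc power_Suc)
  then have "(\<lambda>n. (1 / t) *\<^sub>R (t ^ Suc n / fact (Suc n)) *\<^sub>R ?v n) sums ((1 / t) *\<^sub>R ?s)"
    by (rule sums_scaleR_right)
  moreover have "(1 / t) *\<^sub>R (t ^ Suc n / fact (Suc n)) *\<^sub>R ?v n =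
      ((-1) ^ n / fact (n + 1) * t ^ n) *\<^sub>R (lie_bracket M A ^^ n) X" for n
    using False by (simp add: field_simps del: fact_Suc)
  ultimately have "Z_ad M t A X = (1 / t) *\<^sub>R ?s" by (simp only: Z_ad_def sums_iff)
  then show ?thesis using False by simp
qed (simp add: exp_series_0)

lemma scaled_Z_ad_has_vector_derivative:
  "((\<lambda>t. t *\<^sub>R Z_ad M t A X) has_vector_derivative exp_ad M (- t) A X) (at t)"
proof -
  obtain S :: "'a set" where S: "finite S" "span S = UNIV" using finite_spanning_set by blast
  show ?thesis
    using exp_series_has_vector_derivative[OF S geometric_growth_prepend_zero[OF alternating_powers_growth]]
    by (simp add: scaled_Z_ad_eq_exp_series exp_ad_eq_exp_series)
qed

lemma Z_ad_0: "Z_ad M 0 A X = X"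
proof -
  have "(\<lambda>n. ((- 1) ^ n / fact (n + 1) * 0 ^ n) *\<^sub>R (lie_bracket M A ^^ n) X) sums X"
    using sums_finite[of "{0}" "\<lambda>n. ((- 1) ^ n / fact (n + 1) * 0 ^ n) *\<^sub>R (lie_bracket M A ^^ n) X"]
    by simp
  then show ?thesis by (simp add: Z_ad_def sums_iff)
qed

context
  fixes nabla :: "('g \<Rightarrow> 'a) \<Rightarrow> ('g \<Rightarrow> 'a) \<Rightarrow> ('g \<Rightarrow> 'a)"
  assumes lc: "lifted_levi_civita M nabla"
begin

text \<open>
  Let \<open>x(t) = exp (- t ad\<^sub>A) X\<close>, so \<open>x' = - [A, x]\<close>. As brackets of \<open>A\<close> with vertical vectors are
  horizontal, the vertical part of \<open>x'\<close> depends on the horizontal part of \<open>x\<close> only. Differentiating the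
  horizontal part twice then gives the Jacobi equation, and the initial values can be read off at
  \<open>t = 0\<close>.
\<close>

lemma isotropic_jacobi_solution:
  assumes A: "A \<in> hor M"
  shows "jacobi_solution M nabla U (hor_part M X) A
    (- (1 / 2) *\<^sub>R hor_bracket M A (hor_part M X) - lie_bracket M A (iso_part M X))
    (\<lambda>t. hor_part M (exp_ad M (- t) A X))"
proof (rule jacobi_solutionI[OF lc A])
  let ?x = "\<lambda>t. exp_ad M (- t) A X"
  let ?y' = "\<lambda>t. hor_part M (- lie_bracket M A (?x t))"
  note x' = exp_ad_has_vector_derivative[of A X]
  show "((\<lambda>t. hor_part M (?x t)) has_vector_derivative ?y' t) (at t)" for t
    by (rule linear_has_vector_derivative[OF linear_hor_part x'])
  have lin: "linear (\<lambda>Y. hor_part M (- lie_bracket M A Y))"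
    using linear_compose[OF linear_neg_br linear_hor_part] by (simp add: o_def)
  have "hor_part M (- lie_bracket M A (- lie_bracket M A (?x t))) =
      - hor_bracket M A (?y' t) + jacobi_operator A (hor_part M (?x t))" for t
    by (simp add: linear_neg[OF linear_br] linear_neg[OF linear_hor_part] linear_neg[OF linear_hor_bracket]
        hor_part_bracket[OF A, of "lie_bracket M A (?x t)"] iso_part_bracket[OF A, of "?x t"]
        jacobi_operator_def)
  then show "(?y' has_vector_derivative - hor_bracket M A (?y' t)
      + jacobi_operator A (hor_part M (?x t))) (at t)" for t
    using linear_has_vector_derivative[OF lin x'[of t]] by simp
  show "?y' 0 + (1 / 2) *\<^sub>R hor_bracket M A (hor_part M X) =
      - (1 / 2) *\<^sub>R hor_bracket M A (hor_part M X) - lie_bracket M A (iso_part M X)"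
    by (simp add: exp_ad_0 linear_neg[OF linear_hor_part] hor_part_bracket[OF A])
      (simp add: algebra_simps flip: scaleR_add_left)
qed (simp_all add: exp_ad_0)

text \<open>
  The vector to which \<open>\<Z>\<close> is applied is chosen such that its horizontal part is the ordinary initial
  velocity \<open>E - 1/2 [A, C]\<close> (bracket projected to the horizontal space), and its vertical part is minus
  that of \<open>[A, C]\<close>.
\<close>

definition explicit_jacobi_field :: "'a \<Rightarrow> 'a \<Rightarrow> 'a \<Rightarrow> real \<Rightarrow> 'a" where
  "explicit_jacobi_field C A E t =
    hor_part M (C + t *\<^sub>R Z_ad M t A ((1 / 2) *\<^sub>R hor_bracket M A C + E - lie_bracket M A C))"

text \<open>
  The derivative of the field is the horizontal part of \<open>x(t) = exp (- t ad\<^sub>A) W\<close>. The vertical part of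
  \<open>x\<close> and that of \<open>- [A, y]\<close> have the same derivative, and the same value at \<open>0\<close> by the choice of the
  vertical part of \<open>W\<close>. Hence they agree, and \<open>x' = - [A, x]\<close> becomes the Jacobi equation for \<open>y\<close>.
\<close>

lemma explicit_jacobi_field_solution:
  assumes A: "A \<in> hor M" and C: "C \<in> hor M" and E: "E \<in> hor M"
  shows "jacobi_solution M nabla U C A E (explicit_jacobi_field C A E)"
proof (rule jacobi_solutionI[OF lc A])
  define W where "W = (1 / 2) *\<^sub>R hor_bracket M A C + E - lie_bracket M A C"
  define y where "y = explicit_jacobi_field C A E"
  have y_eq: "y = (\<lambda>t. hor_part M (C + t *\<^sub>R Z_ad M t A W))"
    by (simp add: y_def explicit_jacobi_field_def W_def fun_eq_iff)
  define x where "x t = exp_ad M (- t) A W" for t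
  have x': "(x has_vector_derivative - lie_bracket M A (x t)) (at t)" for t
    unfolding x_def by (rule exp_ad_has_vector_derivative)
  have y_in: "y t \<in> hor M" for t by (simp add: y_eq)
  have y': "(y has_vector_derivative hor_part M (x t)) (at t)" for t
  proof -
    have "((\<lambda>t. C + t *\<^sub>R Z_ad M t A W) has_vector_derivative x t) (at t)"
      using has_vector_derivative_add[OF has_vector_derivative_const[of C] scaled_Z_ad_has_vector_derivative]
      by (simp add: x_def)
    then show ?thesis unfolding y_eq by (rule linear_has_vector_derivative[OF linear_hor_part])
  qed
  have W_iso: "iso_part M W = - iso_part M (lie_bracket M A C)"
    using E by (simp add: W_def linear_add[OF linear_iso_part] linear_diff[OF linear_iso_part]
        linear_scale[OF linear_iso_part] iso_part_hor)
  have iso_x: "iso_part M (x t) = - iso_part M (lie_bracket M A (y t))" for t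
  proof -
    define d where "d t = iso_part M (x t) + iso_part M (lie_bracket M A (y t))" for t
    have lin: "linear (\<lambda>Y. iso_part M (lie_bracket M A Y))"
      using linear_compose[OF linear_br linear_iso_part] by (simp add: o_def)
    have d': "(d has_vector_derivative iso_part M (- lie_bracket M A (x t))
        + iso_part M (lie_bracket M A (hor_part M (x t)))) (at t)" for t
      unfolding d_def
      by (intro has_vector_derivative_add linear_has_vector_derivative[OF linear_iso_part x']
          linear_has_vector_derivative[OF lin y'])
    have "(d has_vector_derivative 0) (at t)" for t
      using d'[of t] by (simp add: linear_neg[OF linear_iso_part] iso_part_bracket[OF A, of "x t"])
    then obtain c where c: "\<And>t. d t = c"
      using has_vector_derivative_zero_constant[of UNIV d] by auto
    have "d 0 = 0" using C by (simp add: d_def x_def y_eq exp_ad_0 W_iso hor_part_hor)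
    then have "d t = 0" using c[of 0] c[of t] by simp
    then show ?thesis by (simp add: d_def add_eq_0_iff)
  qed
  show "explicit_jacobi_field C A E t \<in> hor M" for t using y_in by (simp add: y_def)
  show "(explicit_jacobi_field C A E has_vector_derivative hor_part M (x t)) (at t)" for t
    using y' by (simp add: y_def)
  have "hor_part M (- lie_bracket M A (x t)) =
      - hor_bracket M A (hor_part M (x t)) + jacobi_operator A (y t)" for t
    by (simp add: linear_neg[OF linear_hor_part] hor_part_bracket[OF A] iso_x linear_neg[OF linear_br]
        jacobi_operator_def)
  then show "((\<lambda>t. hor_part M (x t)) has_vector_derivative - hor_bracket M A (hor_part M (x t))
      + jacobi_operator A (explicit_jacobi_field C A E t)) (at t)" for t
    using linear_has_vector_derivative[OF linear_hor_part x'[of t]] by (simp add: y_def)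
  show "explicit_jacobi_field C A E 0 = C"
    using C by (simp add: explicit_jacobi_field_def hor_part_hor)
  show "hor_part M (x 0) + (1 / 2) *\<^sub>R hor_bracket M A C = E"
    using E by (simp add: x_def exp_ad_0 W_def linear_add[OF linear_hor_part] linear_diff[OF linear_hor_part]
        linear_scale[OF linear_hor_part] hor_part_hor flip: hor_bracket_def)
      (simp add: algebra_simps flip: scaleR_add_left)
qed

lemma jacobi_lift_eq:
  assumes "A \<in> hor M" "C \<in> hor M" "E \<in> hor M"
  shows "jacobi_lift M nabla U C A E t = dL M (geodesic_lift M U A t) (explicit_jacobi_field C A E t)"
proof -
  have "(THE y. jacobi_solution M nabla U C A E y) = explicit_jacobi_field C A E"
  proof (rule the_equality)
    show "jacobi_solution M nabla U C A E (explicit_jacobi_field C A E)"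
      by (rule explicit_jacobi_field_solution[OF assms])
    then show "y = explicit_jacobi_field C A E" if "jacobi_solution M nabla U C A E y" for y
      by (rule jacobi_solution_unique[OF lc assms(1) that])
  qed
  then show ?thesis by (simp add: jacobi_lift_def)
qed

text \<open>
  The horizontal part of \<open>exp (- t ad\<^sub>A) X\<close> is itself a Jacobi field, so the given field is of this
  form iff the initial values agree.
\<close>

lemma isotropic_iff:
  assumes A: "A \<in> hor M" and C: "C \<in> hor M" and E: "E \<in> hor M"
  shows "isotropic M U A (jacobi_lift M nabla U C A E) \<longleftrightarrow>
    (\<exists>X. C = hor_part M X \<and> E = - (1/2) *\<^sub>R hor_bracket M A C - lie_bracket M A (iso_part M X))"
proof -
  let ?y = "explicit_jacobi_field C A E"
  have "isotropic M U A (jacobi_lift M nabla U C A E) \<longleftrightarrow>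
      (\<exists>X. \<forall>t. ?y t = hor_part M (exp_ad M (- t) A X))"
  proof -
    have "dL M g X = dL M g Y \<longleftrightarrow> X = Y" for g X Y using dL_inj[OF lie] by blast
    then show ?thesis by (simp add: isotropic_def jacobi_lift_eq[OF assms])
  qed
  also have "\<dots> \<longleftrightarrow> (\<exists>X. C = hor_part M X \<and>
      E = - (1/2) *\<^sub>R hor_bracket M A C - lie_bracket M A (iso_part M X))"
  proof (intro ex_cong1 iffI)
    fix X assume "\<forall>t. ?y t = hor_part M (exp_ad M (- t) A X)"
    then have "?y = (\<lambda>t. hor_part M (exp_ad M (- t) A X))" by (simp add: fun_eq_iff)
    then have "jacobi_solution M nabla U C A E (\<lambda>t. hor_part M (exp_ad M (- t) A X))"
      using explicit_jacobi_field_solution[OF assms, of U] by simp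
    then show "C = hor_part M X \<and> E = - (1/2) *\<^sub>R hor_bracket M A C - lie_bracket M A (iso_part M X)"
      using isotropic_jacobi_solution[OF A, of U X] by (simp add: jacobi_solution_def)
  next
    fix X assume CE: "C = hor_part M X \<and>
      E = - (1/2) *\<^sub>R hor_bracket M A C - lie_bracket M A (iso_part M X)"
    then have "jacobi_solution M nabla U C A E (\<lambda>t. hor_part M (exp_ad M (- t) A X))"
      using isotropic_jacobi_solution[OF A, of U X] by simp
    from jacobi_solution_unique[OF lc A explicit_jacobi_field_solution[OF assms] this]
    show "\<forall>t. ?y t = hor_part M (exp_ad M (- t) A X)" by simp
  qed
  finally show ?thesis .
qed

lemma isotropic_zero_iff:
  assumes A: "A \<in> hor M" and E: "E \<in> hor M"
  shows "isotropic M U A (jacobi_lift M nabla U 0 A E) \<longleftrightarrow>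
    (\<exists>D\<in>isotropy_algebra M. E = - lie_bracket M A D)"
  unfolding isotropic_iff[OF A subspace_0[OF subspace_hor] E] linear_0[OF linear_hor_bracket]
proof safe
  fix X assume "0 = hor_part M X"
  show "\<exists>D\<in>isotropy_algebra M. - (1 / 2) *\<^sub>R 0 - lie_bracket M A (iso_part M X) = - lie_bracket M A D"
    by (rule bexI[OF _ iso_part_in]) simp
next
  fix D assume "D \<in> isotropy_algebra M"
  then show "\<exists>X. 0 = hor_part M X \<and> - lie_bracket M A D = - (1 / 2) *\<^sub>R 0 - lie_bracket M A (iso_part M X)"
    by (intro exI[of _ D]) (simp add: hor_part_iso iso_part_eq)
qed

lemma isotropic_half_bracket:
  assumes A: "A \<in> hor M" and C: "C \<in> hor M"
  shows "isotropic M U A (jacobi_lift M nabla U C A (- (1/2) *\<^sub>R hor_bracket M A C))"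
proof -
  have "- (1/2) *\<^sub>R hor_bracket M A C \<in> hor M"
    by (intro subspace_scale[OF subspace_hor]) simp
  then show ?thesis
    using C by (subst isotropic_iff[OF A C]) (auto intro!: exI[of _ C] simp: hor_part_hor iso_part_eq linear_0[OF linear_br])
qed

lemma jacobi_lift_zero_eq:
  assumes "A \<in> hor M" "V \<in> hor M"
  shows "jacobi_lift M nabla U 0 A V t =
    dL M (geodesic_lift M U A t) (t *\<^sub>R hor_part M (Z_ad M t A V))"
  by (simp add: jacobi_lift_eq[OF assms(1) subspace_0[OF subspace_hor] assms(2)] explicit_jacobi_field_def
      linear_0[OF linear_hor_bracket] linear_0[OF linear_br] linear_scale[OF linear_hor_part])

end

section \<open>Eigenvectors of the horizontal bracket\<close>

context
  fixes A V V' D D' :: 'a and \<omega> :: real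
  assumes A: "A \<in> hor M" and V: "V \<in> hor M" and V': "V' \<in> hor M"
    and D: "D \<in> isotropy_algebra M" and D': "D' \<in> isotropy_algebra M"
    and \<omega>: "\<omega> \<noteq> 0"
    and AV: "lie_bracket M A V = - \<omega> *\<^sub>R V' + D'"
    and AV': "lie_bracket M A V' = \<omega> *\<^sub>R V + D"
    and AD: "lie_bracket M A D = 0" and AD': "lie_bracket M A D' = 0"
begin

lemma bracket_twice: "lie_bracket M A (lie_bracket M A V) = - \<omega>\<^sup>2 *\<^sub>R V - \<omega> *\<^sub>R D"
  by (simp add: AV AV' AD' linear_add[OF linear_br] linear_neg[OF linear_br] linear_diff[OF linear_br]
      linear_scale[OF linear_br] scaleR_add_right power2_eq_square)

text \<open>
  The square of \<open>ad\<^sub>A\<close> maps \<open>V\<close> to \<open>- \<omega>\<^sup>2 V\<close> only up to the vertical term \<open>- \<omega> D\<close>, which one more bracket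
  removes.
\<close>

lemma bracket_thrice:
  "lie_bracket M A (lie_bracket M A (lie_bracket M A V)) = - \<omega>\<^sup>2 *\<^sub>R lie_bracket M A V"
  by (simp add: bracket_twice AD linear_neg[OF linear_br] linear_diff[OF linear_br] linear_scale[OF linear_br])

lemma bracket_odd_power:
  "(lie_bracket M A ^^ Suc (2 * m)) V = (- \<omega>\<^sup>2) ^ m *\<^sub>R lie_bracket M A V"
proof (induction m)
  case (Suc m)
  have "(lie_bracket M A ^^ Suc (2 * Suc m)) V =
      lie_bracket M A (lie_bracket M A ((lie_bracket M A ^^ Suc (2 * m)) V))" by simp
  also have "\<dots> = (- \<omega>\<^sup>2) ^ Suc m *\<^sub>R lie_bracket M A V"
    unfolding Suc by (simp add: linear_scale[OF linear_br] bracket_thrice)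
  finally show ?case .
qed simp

lemma hor_part_even_power: "hor_part M ((lie_bracket M A ^^ (2 * m)) V) = (- \<omega>\<^sup>2) ^ m *\<^sub>R V"
proof (cases m)
  case (Suc j)
  have "(lie_bracket M A ^^ (2 * m)) V = lie_bracket M A ((lie_bracket M A ^^ Suc (2 * j)) V)"
    by (simp add: Suc)
  also have "\<dots> = (- \<omega>\<^sup>2) ^ j *\<^sub>R (- \<omega>\<^sup>2 *\<^sub>R V - \<omega> *\<^sub>R D)"
    unfolding bracket_odd_power by (simp add: linear_scale[OF linear_br] bracket_twice)
  finally show ?thesis
    using V D by (simp add: Suc linear_scale[OF linear_hor_part] linear_diff[OF linear_hor_part]
        linear_neg[OF linear_hor_part] hor_part_hor hor_part_iso)
qed (simp add: V hor_part_hor)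

text \<open>
  Projected to the horizontal space, even powers of \<open>ad\<^sub>A\<close> map \<open>V\<close> to multiples of \<open>V\<close> and odd powers to
  multiples of the horizontal part of \<open>[A, V]\<close>, so the series splits into those of sine and cosine.
  Multiplying by \<open>t\<close> avoids the removable
  singularity at \<open>t = 0\<close>.
\<close>

lemma scaled_Z_ad_eigenvector:
  "t *\<^sub>R hor_part M (Z_ad M t A V) =
    (sin (t * \<omega>) / \<omega>) *\<^sub>R V - ((1 - cos (t * \<omega>)) / \<omega>\<^sup>2) *\<^sub>R hor_bracket M A V"
proof -
  obtain S :: "'a set" where S: "finite S" "span S = UNIV" using finite_spanning_set by blast
  let ?v = "case_nat 0 (\<lambda>n. (- 1) ^ n *\<^sub>R (lie_bracket M A ^^ n) V)"
  \<comment> \<open>Coefficients of the constant \<open>1\<close> in \<open>1 - cos\<close>; the term of index zero on the left is zero.\<close>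
  define c where "c n = (if n = 0 then 1 else 0 :: real)" for n :: nat
  have coeff: "(t ^ n / fact n) *\<^sub>R hor_part M (?v n) =
      (sin_coeff n * (t * \<omega>) ^ n / \<omega>) *\<^sub>R V
      - ((c n - cos_coeff n * (t * \<omega>) ^ n) / \<omega>\<^sup>2) *\<^sub>R hor_bracket M A V" for n
  proof (cases n)
    case 0
    then show ?thesis by (simp add: c_def linear_0[OF linear_hor_part])
  next
    case n: (Suc k)
    show ?thesis
    proof (cases "even k")
      case True
      then obtain m where m: "k = 2 * m" by blast
      have "hor_part M (?v n) = (- \<omega>\<^sup>2) ^ m *\<^sub>R V"
        by (simp add: n m linear_scale[OF linear_hor_part] hor_part_even_power)
      moreover have "(- \<omega>\<^sup>2) ^ m = (- 1) ^ m * \<omega> ^ k"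
        by (simp add: m power_minus[of "\<omega>\<^sup>2"] power_mult)
      ultimately show ?thesis
        using \<omega> by (simp add: n m c_def sin_coeff_def cos_coeff_def power_mult_distrib field_simps del: fact_Suc)
    next
      case False
      then obtain m where m: "k = Suc (2 * m)" by (auto elim: oddE)
      have "hor_part M (?v n) = - ((- \<omega>\<^sup>2) ^ m *\<^sub>R hor_bracket M A V)"
        unfolding n m nat.case bracket_odd_power
        by (simp add: linear_scale[OF linear_hor_part] linear_neg[OF linear_hor_part] hor_bracket_def)
      moreover have "\<omega> ^ n = (\<omega>\<^sup>2) ^ m * \<omega>\<^sup>2"
        by (simp add: n m flip: power_mult power_add del: power_Suc)
      then have "(- \<omega>\<^sup>2) ^ m * \<omega>\<^sup>2 = (- 1) ^ m * \<omega> ^ n"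
        by (simp add: power_minus[of "\<omega>\<^sup>2"])
      then have "(- \<omega>\<^sup>2) ^ m = (- 1) ^ m * \<omega> ^ n / \<omega>\<^sup>2" using \<omega> by (simp add: field_simps)
      ultimately show ?thesis
        by (simp add: n m c_def sin_coeff_def cos_coeff_def power_mult_distrib field_simps del: fact_Suc)
    qed
  qed
  have "c sums 1" using sums_finite[of "{0}" c] by (simp add: c_def)
  then have "(\<lambda>n. (sin_coeff n * (t * \<omega>) ^ n / \<omega>) *\<^sub>R V
      - ((c n - cos_coeff n * (t * \<omega>) ^ n) / \<omega>\<^sup>2) *\<^sub>R hor_bracket M A V) sums
      ((sin (t * \<omega>) / \<omega>) *\<^sub>R V - ((1 - cos (t * \<omega>)) / \<omega>\<^sup>2) *\<^sub>R hor_bracket M A V)"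
    using sin_converges[of "t * \<omega>"] cos_converges[of "t * \<omega>"]
    by (intro sums_diff sums_scaleR_left sums_divide) simp_all
  moreover have "(\<lambda>n. (t ^ n / fact n) *\<^sub>R hor_part M (?v n)) sums
      hor_part M (exp_series ?v t)"
    using bounded_linear.sums[OF linear_imp_bounded_linear[OF linear_hor_part]
        exp_series_sums[OF S geometric_growth_prepend_zero[OF alternating_powers_growth]]]
    by (simp add: linear_scale[OF linear_hor_part])
  ultimately have "hor_part M (exp_series ?v t) =
      (sin (t * \<omega>) / \<omega>) *\<^sub>R V - ((1 - cos (t * \<omega>)) / \<omega>\<^sup>2) *\<^sub>R hor_bracket M A V"
    unfolding coeff by (rule sums_unique2[rotated])
  then show ?thesis
    by (simp only: scaled_Z_ad_eq_exp_series flip: linear_scale[OF linear_hor_part])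
qed

lemma Z_ad_eigenvector:
  "hor_part M (Z_ad M t A V) =
    sin_quot (t * \<omega>) *\<^sub>R V - (t * cos_quot (t * \<omega>)) *\<^sub>R hor_bracket M A V"
proof (cases "t = 0")
  case True
  then show ?thesis using V by (simp add: Z_ad_0 sin_quot_def hor_part_hor)
next
  case False
  have "hor_part M (Z_ad M t A V) = (1 / t) *\<^sub>R t *\<^sub>R hor_part M (Z_ad M t A V)" using False by simp
  also have "\<dots> = sin_quot (t * \<omega>) *\<^sub>R V - (t * cos_quot (t * \<omega>)) *\<^sub>R hor_bracket M A V"
    unfolding scaled_Z_ad_eigenvector
    using False \<omega> by (simp add: sin_quot_def cos_quot_def scaleR_diff_right power2_eq_square)
  finally show ?thesis .
qed

lemma Z_ad_eigenvector_vanishes: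
  assumes "t = 2 * of_int k * pi / \<omega>"
  shows "t *\<^sub>R hor_part M (Z_ad M t A V) = 0"
proof -
  have "t * \<omega> = 2 * pi * of_int k" using assms \<omega> by simp
  then show ?thesis by (simp only: scaled_Z_ad_eigenvector sin_int_2pin cos_int_2pin) simp
qed

end

end

theorem lemma6p9:
  fixes M :: "('g::{t2_space, second_countable_topology}, 'a::real_normed_vector) homogeneous_data"
    and nabla :: "('g \<Rightarrow> 'a) \<Rightarrow> ('g \<Rightarrow> 'a) \<Rightarrow> ('g \<Rightarrow> 'a)"
  assumes "naturally_reductive M"
    and "connected_space (coset_topology M)"
    and "lifted_levi_civita M nabla"
  shows
    "(\<forall>U. \<forall>A\<in>hor M. \<forall>C\<in>hor M. \<forall>E\<in>hor M.
        isotropic M U A (jacobi_lift M nabla U C A E) \<longleftrightarrow>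
        (\<exists>X. C = hor_part M X \<and>
             E = - (1/2) *\<^sub>R hor_bracket M A C - lie_bracket M A (iso_part M X)))
     \<and> (\<forall>U. \<forall>A\<in>hor M. \<forall>E\<in>hor M.
        isotropic M U A (jacobi_lift M nabla U 0 A E) \<longleftrightarrow>
        (\<exists>D\<in>isotropy_algebra M. E = - lie_bracket M A D))
     \<and> (\<forall>U. \<forall>A\<in>hor M. \<forall>C\<in>hor M.
        isotropic M U A (jacobi_lift M nabla U C A (- (1/2) *\<^sub>R hor_bracket M A C)))
     \<and> (\<forall>A\<in>hor M.
        (\<forall>X\<in>hor M. hor_bracket M A X \<in> hor M) \<and>
        (\<forall>X\<in>hor M. \<forall>Y\<in>hor M. form M (hor_bracket M A X) Y = - form M X (hor_bracket M A Y)) \<and>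
        (\<forall>\<mu>. \<forall>V\<in>hor M. \<forall>W\<in>hor M. complex_eigenvector (hor_bracket M A) \<mu> V W \<longrightarrow>
           \<mu> = 0 \<or> (Re \<mu> = 0 \<and> Im \<mu> \<noteq> 0)))
     \<and> (\<forall>A\<in>hor M. \<forall>\<omega>::real. \<forall>V\<in>hor M. \<forall>V'\<in>hor M.
        \<omega> \<noteq> 0 \<longrightarrow> complex_eigenvector (hor_bracket M A) (Complex 0 \<omega>) V V' \<longrightarrow>
        (\<exists>D\<in>isotropy_algebra M. \<exists>D'\<in>isotropy_algebra M.
           lie_bracket M A V = - \<omega> *\<^sub>R V' + D' \<and>
           lie_bracket M A V' = \<omega> *\<^sub>R V + D \<and>
           (lie_bracket M A D' = 0 \<and> lie_bracket M A D = 0 \<longrightarrow>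
              (\<forall>t. hor_part M (Z_ad M t A V) =
                   sin_quot (t * \<omega>) *\<^sub>R V - (t * cos_quot (t * \<omega>)) *\<^sub>R hor_bracket M A V) \<and>
              (\<forall>(k::int) t. t = 2 * of_int k * pi / \<omega> \<longrightarrow>
                 t *\<^sub>R hor_part M (Z_ad M t A V) = 0 \<and>
                 (\<forall>U. jacobi_lift M nabla U 0 A V t = (\<lambda>_. 0))))) \<and>
        ((\<forall>D\<in>isotropy_algebra M. lie_bracket M A D = 0) \<longrightarrow>
           (\<forall>t. hor_part M (Z_ad M t A V) =
                sin_quot (t * \<omega>) *\<^sub>R V - (t * cos_quot (t * \<omega>)) *\<^sub>R hor_bracket M A V)))"
proof (intro conjI allI ballI impI)
  note nr = assms(1) and lc = assms(3)
  show "isotropic M U A (jacobi_lift M nabla U C A E) \<longleftrightarrow>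
      (\<exists>X. C = hor_part M X \<and>
           E = - (1/2) *\<^sub>R hor_bracket M A C - lie_bracket M A (iso_part M X))"
    if "A \<in> hor M" "C \<in> hor M" "E \<in> hor M" for U A C E
    using that by (rule isotropic_iff[OF nr lc])
  show "isotropic M U A (jacobi_lift M nabla U 0 A E) \<longleftrightarrow>
      (\<exists>D\<in>isotropy_algebra M. E = - lie_bracket M A D)"
    if "A \<in> hor M" "E \<in> hor M" for U A E
    using that by (rule isotropic_zero_iff[OF nr lc])
  show "isotropic M U A (jacobi_lift M nabla U C A (- (1/2) *\<^sub>R hor_bracket M A C))"
    if "A \<in> hor M" "C \<in> hor M" for U A C
    using that by (rule isotropic_half_bracket[OF nr lc])
  show "hor_bracket M A X \<in> hor M" for A X
    by (rule hor_bracket_in[OF nr])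
  show "form M (hor_bracket M A X) Y = - form M X (hor_bracket M A Y)"
    if "A \<in> hor M" "X \<in> hor M" "Y \<in> hor M" for A X Y
    using that(2,3,1) by (rule form_hor_bracket[OF nr])
  show "\<mu> = 0 \<or> (Re \<mu> = 0 \<and> Im \<mu> \<noteq> 0)"
    if "A \<in> hor M" "V \<in> hor M" "W \<in> hor M" "complex_eigenvector (hor_bracket M A) \<mu> V W" for A \<mu> V W
    using hor_bracket_eigenvalue_imaginary[OF nr that] by (auto simp: complex_eq_iff)
next
  note nr = assms(1) and lc = assms(3)
  fix A V V' and \<omega> :: real
  assume A: "A \<in> hor M" and V: "V \<in> hor M" and V': "V' \<in> hor M" and \<omega>: "\<omega> \<noteq> 0"
    and eig: "complex_eigenvector (hor_bracket M A) (Complex 0 \<omega>) V V'"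
  define D where "D = iso_part M (lie_bracket M A V')"
  define D' where "D' = iso_part M (lie_bracket M A V)"
  have D: "D \<in> isotropy_algebra M" and D': "D' \<in> isotropy_algebra M"
    by (simp_all add: D_def D'_def iso_part_in[OF nr])
  have AV: "lie_bracket M A V = - \<omega> *\<^sub>R V' + D'" and AV': "lie_bracket M A V' = \<omega> *\<^sub>R V + D"
    using eig by (simp_all add: complex_eigenvector_def D_def D'_def iso_part_eq[OF nr] hor_bracket_def)
  note formula = Z_ad_eigenvector[OF nr A V V' D D' \<omega> AV AV']
  have vanish: "t *\<^sub>R hor_part M (Z_ad M t A V) = 0"
    if "lie_bracket M A D = 0" "lie_bracket M A D' = 0" "t = 2 * of_int k * pi / \<omega>" for k :: int and t
    by (rule Z_ad_eigenvector_vanishes[OF nr A V V' D D' \<omega> AV AV' that])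
  have "jacobi_lift M nabla U 0 A V t = (\<lambda>_. 0)"
    if "lie_bracket M A D = 0" "lie_bracket M A D' = 0" "t = 2 * of_int k * pi / \<omega>" for k :: int and t U
    unfolding jacobi_lift_zero_eq[OF nr lc A V] vanish[OF that] by (rule dL_zero[OF lie[OF nr]])
  then show "\<exists>D\<in>isotropy_algebra M. \<exists>D'\<in>isotropy_algebra M.
      lie_bracket M A V = - \<omega> *\<^sub>R V' + D' \<and>
      lie_bracket M A V' = \<omega> *\<^sub>R V + D \<and>
      (lie_bracket M A D' = 0 \<and> lie_bracket M A D = 0 \<longrightarrow>
         (\<forall>t. hor_part M (Z_ad M t A V) =
              sin_quot (t * \<omega>) *\<^sub>R V - (t * cos_quot (t * \<omega>)) *\<^sub>R hor_bracket M A V) \<and>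
         (\<forall>(k::int) t. t = 2 * of_int k * pi / \<omega> \<longrightarrow>
            t *\<^sub>R hor_part M (Z_ad M t A V) = 0 \<and>
            (\<forall>U. jacobi_lift M nabla U 0 A V t = (\<lambda>_. 0))))"
    using formula vanish AV AV' by (intro bexI[OF _ D] bexI[OF _ D']) blast
  show "hor_part M (Z_ad M t A V) =
      sin_quot (t * \<omega>) *\<^sub>R V - (t * cos_quot (t * \<omega>)) *\<^sub>R hor_bracket M A V"
    if "\<forall>D\<in>isotropy_algebra M. lie_bracket M A D = 0" for t
    using formula that D D' by blast
qed

end
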